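(* Let $\lambda^-\in\overline{C}^-_{\mathbb Z}$. Let $w=t_{\ell\theta}x\in W_\ell$ (with $\theta\in Q$, $x\in W$) be minimal dominant for $\lambda^-$, and put $\lambda=w\cdot\lambda^-$. Set $s=|\Phi^+_\lambda|$ and $$a_{\lambda^-}=\left|\{\alpha\in\Phi^+_{\lambda^-}:\langle\lambda^-+\rho,\alpha^\vee\rangle=-\ell\}\right|.$$ Let $D_\lambda(t)=\prod_{\alpha\in\Phi^+}\left(t^{d_\alpha\langle\lambda+\rho,\alpha^\vee\rangle}-t^{-d_\alpha\langle\lambda+\rho,\alpha^\vee\rangle}\right)\in\mathbb Z[t,t^{-1}]$ and let $D_\lambda^{(s)}(t)=\frac{d^s}{dt^s}D_\lambda(t)$ be its $s$-th derivative. Then $D^{(s)}_\lambda(\zeta)\ne0$ and $$D^{(s)}_\lambda(\zeta)=(-1)^{l(w)-a_{\lambda^-}}\,(s!)\left(\prod_{\alpha\in\Phi^+_\lambda}2d_\alpha\langle\lambda+\rho,\alpha^\vee\rangle\,\zeta^{-1}\right)\left(\prod_{\alpha\in\Phi^+\setminus\Phi^+_{\lambda^-}}\left(\zeta^{d_\alpha\langle\lambda^-+\rho,\alpha^\vee\rangle}-\zeta^{-d_\alpha\langle\lambda^-+\rho,\alpha^\vee\rangle}\right)\right).$$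
   Context: $\Phi$ is an irreducible (reduced, crystallographic) root system spanning the Euclidean space $\mathbb E$, with inner product $\langle\cdot,\cdot\rangle$ normalized so that $\langle\alpha,\alpha\rangle=2$ for short roots $\alpha$ (all roots are short in the simply laced case). $\alpha^\vee=2\alpha/\langle\alpha,\alpha\rangle$; $d_\alpha=\langle\alpha,\alpha\rangle/2\in\{1,2,3\}$. $\Pi$ is a set of simple roots, $\Phi^+$ the positive roots, $\alpha_0$ the maximal short root, $Q=\mathbb Z\Phi$, $X$ the weight lattice, $X^+$ the dominant weights, $\rho=\frac12\sum_{\alpha\in\Phi^+}\alpha$, $h=\langle\rho,\alpha_0^\vee\rangle+1$ the Coxeter number, $W$ the Weyl group. Standing assumption: $\ell$ is an odd positive integer, $\ell>h$, coprime to every bad prime of $\Phi$ (bad primes: none in type $A$; $2$ in types $B,C,D$; $2,3$ in types $E_6,E_7,F_4,G_2$; $2,3,5$ in type $E_8$). $\zeta\in\mathbb C$ is a primitive $\ell$-th root of unity. $W_\ell$ is the affine Weyl group: the group of affine transformations of $\mathbb E$ generated by $s_{\alpha,r}(x)=x-(\langle x,\alpha^\vee\rangle-r\ell)\alpha$, $\alpha\in\Phi$, $r\in\mathbb Z$. For $\theta\in Q$, $t_{\ell\theta}(x)=x+\ell\theta$; every $w\in W_\ell$ is uniquely $t_{\ell\theta}x$ with $\theta\in Q$, $x\in W$. $W_\ell$ is a Coxeter group with generators $\{s_\alpha:\alpha\in\Pi\}\cup\{s_{\alpha_0,-1}\}$ (where $s_\alpha=s_{\alpha,0}$) and length function $l$.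 The dot action is $w\cdot\lambda=w(\lambda+\rho)-\rho$. $\overline{C}^-_{\mathbb Z}=\{\lambda\in X:-\ell\le\langle\lambda+\rho,\alpha^\vee\rangle\le0\ \forall\alpha\in\Phi^+\}$. An element $w\in W_\ell$ is dominant for $\lambda^-$ if $w\cdot\lambda^-\in X^+$; it is minimal dominant for $\lambda^-$ if moreover it has minimal length among all $y\in W_\ell$ with $y\cdot\lambda^-=w\cdot\lambda^-$. For $\mu\in X$, $\Phi_\mu=\{\alpha\in\Phi:\langle\mu+\rho,\alpha^\vee\rangle\equiv0\bmod\ell\}$ and $\Phi^+_\mu=\Phi_\mu\cap\Phi^+$. *)

theory Defs
  imports
    "HOL-Analysis.Analysis"
    "HOL-Algebra.Bij"
    "HOL-Algebra.Generated_Groups"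
    "HOL-Computational_Algebra.Formal_Laurent_Series"
    "HOL-Computational_Algebra.Primes"
begin

section \<open>Root systems\<close>

definition coroot :: "'a::euclidean_space \<Rightarrow> 'a" where
  "coroot \<alpha> = (2 / (\<alpha> \<bullet> \<alpha>)) *\<^sub>R \<alpha>"

definition root_reflection :: "'a::euclidean_space \<Rightarrow> 'a \<Rightarrow> 'a" where
  "root_reflection \<alpha> x = x - (x \<bullet> coroot \<alpha>) *\<^sub>R \<alpha>"

text \<open>Reduced crystallographic root systems spanning the ambient Euclidean space.\<close>

definition root_system :: "'a::euclidean_space set \<Rightarrow> bool" where
  "root_system \<Phi> \<longleftrightarrow>
     finite \<Phi> \<and> 0 \<notin> \<Phi> \<and> span \<Phi> = UNIV \<and>
     (\<forall>\<alpha>\<in>\<Phi>. root_reflection \<alpha> ` \<Phi> = \<Phi>) \<and>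
     (\<forall>\<alpha>\<in>\<Phi>. \<forall>\<beta>\<in>\<Phi>. \<beta> \<bullet> coroot \<alpha> \<in> \<int>) \<and>
     (\<forall>\<alpha>\<in>\<Phi>. \<forall>c::real. c *\<^sub>R \<alpha> \<in> \<Phi> \<longrightarrow> c = 1 \<or> c = - 1)"

definition irreducible_root_system :: "'a::euclidean_space set \<Rightarrow> bool" where
  "irreducible_root_system \<Phi> \<longleftrightarrow>
     root_system \<Phi> \<and> \<Phi> \<noteq> {} \<and>
     (\<nexists>A B. A \<noteq> {} \<and> B \<noteq> {} \<and> A \<inter> B = {} \<and> A \<union> B = \<Phi> \<and>
            (\<forall>\<alpha>\<in>A. \<forall>\<beta>\<in>B. \<alpha> \<bullet> \<beta> = 0))"

text \<open>In the simply laced case all roots are short.\<close>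

definition short_roots :: "'a::euclidean_space set \<Rightarrow> 'a set" where
  "short_roots \<Phi> = {\<alpha>\<in>\<Phi>. \<forall>\<beta>\<in>\<Phi>. \<alpha> \<bullet> \<alpha> \<le> \<beta> \<bullet> \<beta>}"

definition normalized :: "'a::euclidean_space set \<Rightarrow> bool" where
  "normalized \<Phi> \<longleftrightarrow> (\<forall>\<alpha>\<in>short_roots \<Phi>. \<alpha> \<bullet> \<alpha> = 2)"

text \<open>The number \<open>d\<^sub>\<alpha> \<in> {1, 2, 3}\<close> of a root of a normalized irreducible root system.\<close>

definition half_norm :: "'a::euclidean_space \<Rightarrow> real" where
  "half_norm \<alpha> = (\<alpha> \<bullet> \<alpha>) / 2"

definition simple_roots :: "'a::euclidean_space set \<Rightarrow> 'a set \<Rightarrow> bool" where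
  "simple_roots \<Phi> \<Delta> \<longleftrightarrow>
     \<Delta> \<subseteq> \<Phi> \<and> independent \<Delta> \<and> span \<Delta> = UNIV \<and>
     (\<forall>\<alpha>\<in>\<Phi>. \<exists>c::'a \<Rightarrow> int. \<alpha> = (\<Sum>\<delta>\<in>\<Delta>. of_int (c \<delta>) *\<^sub>R \<delta>) \<and>
        ((\<forall>\<delta>\<in>\<Delta>. c \<delta> \<ge> 0) \<or> (\<forall>\<delta>\<in>\<Delta>. c \<delta> \<le> 0)))"

definition nat_cone :: "'a::euclidean_space set \<Rightarrow> 'a set" where
  "nat_cone \<Delta> = {(\<Sum>\<delta>\<in>\<Delta>. of_nat (c \<delta>) *\<^sub>R \<delta>) | c::'a \<Rightarrow> nat. True}"

definition pos_roots :: "'a::euclidean_space set \<Rightarrow> 'a set \<Rightarrow> 'a set" where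
  "pos_roots \<Phi> \<Delta> = \<Phi> \<inter> nat_cone \<Delta>"

text \<open>Maximality refers to the order in which \<open>\<beta> \<le> \<alpha>\<close> means that \<open>\<alpha> - \<beta>\<close> is a
  sum of simple roots.\<close>

definition maximal_short_root :: "'a::euclidean_space set \<Rightarrow> 'a set \<Rightarrow> 'a \<Rightarrow> bool" where
  "maximal_short_root \<Phi> \<Delta> \<alpha>0 \<longleftrightarrow>
     \<alpha>0 \<in> short_roots \<Phi> \<and> (\<forall>\<beta>\<in>short_roots \<Phi>. \<beta> - \<alpha>0 \<in> nat_cone \<Delta> \<longrightarrow> \<beta> = \<alpha>0)"

definition root_lattice :: "'a::euclidean_space set \<Rightarrow> 'a set" where
  "root_lattice \<Phi> = {(\<Sum>\<alpha>\<in>\<Phi>. of_int (c \<alpha>) *\<^sub>R \<alpha>) | c::'a \<Rightarrow> int. True}"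

definition weight_lattice :: "'a::euclidean_space set \<Rightarrow> 'a set" where
  "weight_lattice \<Phi> = {\<mu>. \<forall>\<alpha>\<in>\<Phi>. \<mu> \<bullet> coroot \<alpha> \<in> \<int>}"

definition dominant_weights :: "'a::euclidean_space set \<Rightarrow> 'a set \<Rightarrow> 'a set" where
  "dominant_weights \<Phi> \<Delta> = {\<mu>\<in>weight_lattice \<Phi>. \<forall>\<alpha>\<in>\<Delta>. \<mu> \<bullet> coroot \<alpha> \<ge> 0}"

definition rho :: "'a::euclidean_space set \<Rightarrow> 'a set \<Rightarrow> 'a" where
  "rho \<Phi> \<Delta> = (1 / 2) *\<^sub>R (\<Sum>\<alpha>\<in>pos_roots \<Phi> \<Delta>. \<alpha>)"

definition coxeter_number :: "'a::euclidean_space set \<Rightarrow> 'a set \<Rightarrow> 'a \<Rightarrow> real" where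
  "coxeter_number \<Phi> \<Delta> \<alpha>0 = rho \<Phi> \<Delta> \<bullet> coroot \<alpha>0 + 1"


section \<open>Dynkin types and bad primes\<close>

datatype dynkin_type =
  TypeA nat | TypeB nat | TypeC nat | TypeD nat | TypeE6 | TypeE7 | TypeE8 | TypeF4 | TypeG2

fun type_rank :: "dynkin_type \<Rightarrow> nat" where
  "type_rank (TypeA n) = n"
| "type_rank (TypeB n) = n"
| "type_rank (TypeC n) = n"
| "type_rank (TypeD n) = n"
| "type_rank TypeE6 = 6"
| "type_rank TypeE7 = 7"
| "type_rank TypeE8 = 8"
| "type_rank TypeF4 = 4"
| "type_rank TypeG2 = 2"

fun valid_type :: "dynkin_type \<Rightarrow> bool" where
  "valid_type (TypeA n) = (n \<ge> 1)"
| "valid_type (TypeB n) = (n \<ge> 2)"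
| "valid_type (TypeC n) = (n \<ge> 3)"
| "valid_type (TypeD n) = (n \<ge> 4)"
| "valid_type _ = True"

definition chain :: "nat \<Rightarrow> nat \<Rightarrow> nat set set" where
  "chain m n = {{i, Suc i} | i. m \<le> i \<and> i < n}"

definition graph_entry :: "nat set set \<Rightarrow> nat \<Rightarrow> nat \<Rightarrow> int" where
  "graph_entry E i j = (if i = j then 2 else if {i, j} \<in> E then - 1 else 0)"

text \<open>The Cartan integer \<open>\<langle>\<alpha>\<^sub>i, \<alpha>\<^sub>j\<^sup>\<or>\<rangle>\<close> in Bourbaki's numbering of the simple roots
  \<open>\<alpha>\<^sub>1, \<dots>, \<alpha>\<^sub>n\<close>. An entry \<open>-2\<close> or \<open>-3\<close> in position \<open>(i, j)\<close> says that
  \<open>\<alpha>\<^sub>i\<close> is longer than \<open>\<alpha>\<^sub>j\<close>.\<close>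

fun cartan_entry :: "dynkin_type \<Rightarrow> nat \<Rightarrow> nat \<Rightarrow> int" where
  "cartan_entry (TypeA n) i j = graph_entry (chain 1 n) i j"
| "cartan_entry (TypeB n) i j =
     (if Suc i = n \<and> j = n then - 2 else graph_entry (chain 1 n) i j)"
| "cartan_entry (TypeC n) i j =
     (if i = n \<and> Suc j = n then - 2 else graph_entry (chain 1 n) i j)"
| "cartan_entry (TypeD n) i j = graph_entry (insert {n - 2, n} (chain 1 (n - 1))) i j"
| "cartan_entry TypeE6 i j = graph_entry ({{1, 3}, {2, 4}} \<union> chain 3 6) i j"
| "cartan_entry TypeE7 i j = graph_entry ({{1, 3}, {2, 4}} \<union> chain 3 7) i j"
| "cartan_entry TypeE8 i j = graph_entry ({{1, 3}, {2, 4}} \<union> chain 3 8) i j"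
| "cartan_entry TypeF4 i j = (if i = 2 \<and> j = 3 then - 2 else graph_entry (chain 1 4) i j)"
| "cartan_entry TypeG2 i j = (if i = 2 \<and> j = 1 then - 3 else graph_entry (chain 1 2) i j)"

definition has_dynkin_type :: "'a::euclidean_space set \<Rightarrow> dynkin_type \<Rightarrow> bool" where
  "has_dynkin_type \<Delta> T \<longleftrightarrow> valid_type T \<and>
     (\<exists>b. bij_betw b {1..type_rank T} \<Delta> \<and>
          (\<forall>i\<in>{1..type_rank T}. \<forall>j\<in>{1..type_rank T}.
             b i \<bullet> coroot (b j) = of_int (cartan_entry T i j)))"

fun bad_primes_of_type :: "dynkin_type \<Rightarrow> nat set" where
  "bad_primes_of_type (TypeA n) = {}"
| "bad_primes_of_type (TypeB n) = {2}"
| "bad_primes_of_type (TypeC n) = {2}"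
| "bad_primes_of_type (TypeD n) = {2}"
| "bad_primes_of_type TypeE6 = {2, 3}"
| "bad_primes_of_type TypeE7 = {2, 3}"
| "bad_primes_of_type TypeE8 = {2, 3, 5}"
| "bad_primes_of_type TypeF4 = {2, 3}"
| "bad_primes_of_type TypeG2 = {2, 3}"

definition bad_prime :: "'a::euclidean_space set \<Rightarrow> nat \<Rightarrow> bool" where
  "bad_prime \<Delta> p \<longleftrightarrow> (\<exists>T. has_dynkin_type \<Delta> T \<and> p \<in> bad_primes_of_type T)"

definition primitive_root_of_unity :: "nat \<Rightarrow> complex \<Rightarrow> bool" where
  "primitive_root_of_unity n z \<longleftrightarrow> n > 0 \<and> z ^ n = 1 \<and> (\<forall>k. 0 < k \<and> k < n \<longrightarrow> z ^ k \<noteq> 1)"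


section \<open>The affine Weyl group\<close>

definition weyl_group :: "'a::euclidean_space set \<Rightarrow> ('a \<Rightarrow> 'a) set" where
  "weyl_group \<Phi> = generate (BijGroup UNIV) (root_reflection ` \<Phi>)"

definition affine_reflection :: "nat \<Rightarrow> 'a::euclidean_space \<Rightarrow> int \<Rightarrow> 'a \<Rightarrow> 'a" where
  "affine_reflection ell \<alpha> r x = x - (x \<bullet> coroot \<alpha> - of_int r * of_nat ell) *\<^sub>R \<alpha>"

definition affine_weyl_group :: "'a::euclidean_space set \<Rightarrow> nat \<Rightarrow> ('a \<Rightarrow> 'a) set" where
  "affine_weyl_group \<Phi> ell =
     generate (BijGroup UNIV) {affine_reflection ell \<alpha> r | \<alpha> r. \<alpha> \<in> \<Phi>}"

definition translation :: "'a::euclidean_space \<Rightarrow> 'a \<Rightarrow> 'a" where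
  "translation v x = x + v"

definition coxeter_generators :: "'a::euclidean_space set \<Rightarrow> 'a \<Rightarrow> nat \<Rightarrow> ('a \<Rightarrow> 'a) set" where
  "coxeter_generators \<Delta> \<alpha>0 ell =
     (\<lambda>\<alpha>. affine_reflection ell \<alpha> 0) ` \<Delta> \<union> {affine_reflection ell \<alpha>0 (- 1)}"

definition coxeter_length :: "'a::euclidean_space set \<Rightarrow> 'a \<Rightarrow> nat \<Rightarrow> ('a \<Rightarrow> 'a) \<Rightarrow> nat" where
  "coxeter_length \<Delta> \<alpha>0 ell w =
     (LEAST n. \<exists>ws. length ws = n \<and> set ws \<subseteq> coxeter_generators \<Delta> \<alpha>0 ell \<and>
                    w = foldr (\<circ>) ws id)"

definition dot_action ::
  "'a::euclidean_space set \<Rightarrow> 'a set \<Rightarrow> ('a \<Rightarrow> 'a) \<Rightarrow> 'a \<Rightarrow> 'a" where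
  "dot_action \<Phi> \<Delta> w \<mu> = w (\<mu> + rho \<Phi> \<Delta>) - rho \<Phi> \<Delta>"

definition closed_antidominant_alcove_weights ::
  "'a::euclidean_space set \<Rightarrow> 'a set \<Rightarrow> nat \<Rightarrow> 'a set" where
  "closed_antidominant_alcove_weights \<Phi> \<Delta> ell =
     {\<mu>\<in>weight_lattice \<Phi>. \<forall>\<alpha>\<in>pos_roots \<Phi> \<Delta>.
        - of_nat ell \<le> (\<mu> + rho \<Phi> \<Delta>) \<bullet> coroot \<alpha> \<and> (\<mu> + rho \<Phi> \<Delta>) \<bullet> coroot \<alpha> \<le> 0}"

definition minimal_dominant ::
  "'a::euclidean_space set \<Rightarrow> 'a set \<Rightarrow> 'a \<Rightarrow> nat \<Rightarrow> 'a \<Rightarrow> ('a \<Rightarrow> 'a) \<Rightarrow> bool" where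
  "minimal_dominant \<Phi> \<Delta> \<alpha>0 ell \<mu> w \<longleftrightarrow>
     w \<in> affine_weyl_group \<Phi> ell \<and>
     dot_action \<Phi> \<Delta> w \<mu> \<in> dominant_weights \<Phi> \<Delta> \<and>
     (\<forall>y\<in>affine_weyl_group \<Phi> ell. dot_action \<Phi> \<Delta> y \<mu> = dot_action \<Phi> \<Delta> w \<mu> \<longrightarrow>
        coxeter_length \<Delta> \<alpha>0 ell w \<le> coxeter_length \<Delta> \<alpha>0 ell y)"

text \<open>\<open>\<Phi>\<^sub>\<mu>\<close>: since \<open>\<langle>\<mu> + \<rho>, \<alpha>\<^sup>\<or>\<rangle>\<close> is real-valued here, divisibility by \<open>ell\<close> is spelled
  out instead of being stated as a congruence.\<close>

definition singular_roots ::
  "'a::euclidean_space set \<Rightarrow> 'a set \<Rightarrow> nat \<Rightarrow> 'a \<Rightarrow> 'a set" where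
  "singular_roots \<Phi> \<Delta> ell \<mu> =
     {\<alpha>\<in>\<Phi>. \<exists>k::int. (\<mu> + rho \<Phi> \<Delta>) \<bullet> coroot \<alpha> = of_int k * of_nat ell}"

definition singular_pos_roots ::
  "'a::euclidean_space set \<Rightarrow> 'a set \<Rightarrow> nat \<Rightarrow> 'a \<Rightarrow> 'a set" where
  "singular_pos_roots \<Phi> \<Delta> ell \<mu> = singular_roots \<Phi> \<Delta> ell \<mu> \<inter> pos_roots \<Phi> \<Delta>"


section \<open>The Laurent polynomial\<close>

text \<open>For a weight \<open>\<mu>\<close> the real number under the floor is an integer, so the floor only
  changes the type.\<close>

definition root_exponent ::
  "'a::euclidean_space set \<Rightarrow> 'a set \<Rightarrow> 'a \<Rightarrow> 'a \<Rightarrow> int" where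
  "root_exponent \<Phi> \<Delta> \<mu> \<alpha> = \<lfloor>half_norm \<alpha> * ((\<mu> + rho \<Phi> \<Delta>) \<bullet> coroot \<alpha>)\<rfloor>"

text \<open>Elements of \<open>\<int>[t, t\<^sup>-\<^sup>1]\<close> are formal Laurent series with finitely many nonzero
  coefficients; \<open>fls_X_intpow n\<close> is \<open>t\<^sup>n\<close>.\<close>

definition weyl_denominator_poly ::
  "'a::euclidean_space set \<Rightarrow> 'a set \<Rightarrow> 'a \<Rightarrow> int fls" where
  "weyl_denominator_poly \<Phi> \<Delta> \<mu> =
     (\<Prod>\<alpha>\<in>pos_roots \<Phi> \<Delta>.
        fls_X_intpow (root_exponent \<Phi> \<Delta> \<mu> \<alpha>) - fls_X_intpow (- root_exponent \<Phi> \<Delta> \<mu> \<alpha>))"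

text \<open>Meaningful only for Laurent polynomials: the sum over an infinite support is \<open>0\<close>.\<close>

definition laurent_eval :: "int fls \<Rightarrow> complex \<Rightarrow> complex" where
  "laurent_eval f z = (\<Sum>n | fls_nth f n \<noteq> 0. of_int (fls_nth f n) * z powi n)"

end

theory Submission
  imports Defs
begin

text \<open>Write \<open>u = \<mu>m + \<rho>\<close>, \<open>v = \<mu> + \<rho> = w u = x u + ell \<theta>\<close>, and let \<open>y\<close> be the inverse of \<open>x\<close>.
The factor of the Laurent polynomial at a positive root \<open>\<alpha>\<close> is \<open>t\<^sup>n - t\<^sup>-\<^sup>n\<close> with
\<open>n = \<langle>v, \<alpha>\<rangle>\<close>, the integer \<open>d\<^sub>\<alpha> \<langle>v, \<alpha>\<^sup>\<or>\<rangle>\<close>. It vanishes at \<open>\<zeta>\<close> exactly if \<open>ell\<close> divides \<open>2 n\<close>.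
Since \<open>ell\<close> is odd and prime to \<open>d\<^sub>\<alpha>\<close>, this means that \<open>\<alpha>\<close> is singular for \<open>\<mu>\<close>; the only
delicate value is \<open>d\<^sub>\<alpha> = 3\<close>, which forces type \<open>G\<^sub>2\<close>, where 3 is a bad prime
(\<open>triple_length_G2\<close>). By the product rule the \<open>s\<close>-th derivative at \<open>\<zeta>\<close> is therefore \<open>s!\<close>
times the derivatives \<open>2 n \<zeta>\<^sup>-\<^sup>1\<close> of the \<open>s\<close> vanishing factors times the values of the
remaining ones (\<open>laurent_eval_derivs_prod\<close>).

As \<open>\<zeta>\<close> has order \<open>ell\<close>, the value of the factor at \<open>\<alpha>\<close> depends only on \<open>\<langle>u, y \<alpha>\<rangle>\<close>: it is the value
belonging to \<open>u\<close> and the root \<open>y \<alpha>\<close>. Now \<open>y\<close> permutes the roots, and passing from a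
negative \<open>y \<alpha>\<close> to its opposite reverses the sign of the value. So the products over the nonsingular
positive roots of \<open>\<mu>\<close> and of \<open>\<mu>m\<close> agree up to \<open>(-1)\<^sup>N\<close>, where \<open>N\<close> counts the nonsingular positive \<open>\<alpha>\<close>
with \<open>y \<alpha>\<close> negative. It remains to see that \<open>N\<close> has the parity of \<open>l(w) - a\<close>, which follows from
two facts.

First, the number of all positive \<open>\<alpha>\<close> with \<open>y \<alpha>\<close> negative has the parity of \<open>l(w)\<close>
(\<open>parity_length\<close>). Indeed the linear parts of the Coxeter generators are reflections, and every
reflection reverses the sign of the function \<open>\<Prod>\<^sub>\<alpha> \<langle>\<cdot>, \<alpha>\<rangle>\<close> (\<open>alternant_reflection\<close>).

Second, exactly \<open>a\<close> of these \<open>\<alpha>\<close> are singular for \<open>\<mu>\<close> (\<open>card_singular_sign_changes\<close>). Here the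
minimality of \<open>w\<close> enters. Let \<open>H\<close> be a reflection hyperplane through \<open>v\<close>. If \<open>H\<close> separated \<open>w (- \<rho>)\<close>
from \<open>- \<rho>\<close>, then the reflection in \<open>H\<close> would turn \<open>w\<close> into a shorter element (\<open>deletion\<close>) that still
maps \<open>u\<close> to \<open>v\<close>. So the two points lie on the same side, and pulling this back by \<open>w\<close> decides for every
singular root in which wall of the closed alcove \<open>u\<close> lies: \<open>u\<close> pairs to 0 with the coroot of
\<open>y \<alpha>\<close> if \<open>y \<alpha>\<close> is positive, and to \<open>- ell\<close> with that of \<open>- y \<alpha>\<close> otherwise.

The point \<open>- \<rho>\<close> stands for the antidominant alcove: because \<open>ell\<close> exceeds the Coxeter number, it lies in
the interior (\<open>rho_coroot_le_short\<close>), and every affine root takes an integer value there, which also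
gives the descent showing that the Coxeter generators generate the affine Weyl group
(\<open>affine_reflection_word_pos\<close>). Both this and the deletion property rest on
\<open>flip_only_own_wall\<close>.\<close>

section \<open>Evaluating and differentiating Laurent polynomials\<close>

definition laurent_polynomial :: "int fls \<Rightarrow> bool" where
  "laurent_polynomial f \<longleftrightarrow> finite {n. fls_nth f n \<noteq> 0}"

lemma laurent_eval_superset:
  assumes "finite S" "{n. fls_nth f n \<noteq> 0} \<subseteq> S"
  shows "laurent_eval f z = (\<Sum>n\<in>S. of_int (fls_nth f n) * z powi n)"
  unfolding laurent_eval_def using assms by (intro sum.mono_neutral_left) auto

lemma laurent_polynomial_add:
  assumes "laurent_polynomial f" "laurent_polynomial g"
  shows "laurent_polynomial (f + g)" "laurent_eval (f + g) z = laurent_eval f z + laurent_eval g z"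
proof -
  let ?S = "{n. fls_nth f n \<noteq> 0} \<union> {n. fls_nth g n \<noteq> 0}"
  have fin: "finite ?S" using assms by (simp add: laurent_polynomial_def)
  have sub: "{n. fls_nth (f + g) n \<noteq> 0} \<subseteq> ?S" by auto
  show "laurent_polynomial (f + g)"
    using finite_subset[OF sub fin] by (simp add: laurent_polynomial_def)
  show "laurent_eval (f + g) z = laurent_eval f z + laurent_eval g z"
    using laurent_eval_superset[OF fin sub, of z] laurent_eval_superset[OF fin, of f z]
      laurent_eval_superset[OF fin, of g z]
    by (simp add: algebra_simps sum.distrib)
qed

definition laurent_monomial :: "int \<Rightarrow> int \<Rightarrow> int fls" where
  "laurent_monomial c n = fls_const c * fls_X_intpow n"

lemma laurent_monomial_nth: "fls_nth (laurent_monomial c n) m = (if m = n then c else 0)"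
  by (simp add: laurent_monomial_def)

lemma laurent_monomial:
  "laurent_polynomial (laurent_monomial c n)"
  "laurent_eval (laurent_monomial c n) z = of_int c * z powi n"
proof -
  have sub: "{m. fls_nth (laurent_monomial c n) m \<noteq> 0} \<subseteq> {n}" by (auto simp: laurent_monomial_nth)
  show "laurent_polynomial (laurent_monomial c n)"
    unfolding laurent_polynomial_def by (rule finite_subset[OF sub]) simp
  show "laurent_eval (laurent_monomial c n) z = of_int c * z powi n"
    by (subst laurent_eval_superset[OF _ sub]) (simp_all add: laurent_monomial_nth)
qed

lemma laurent_polynomial_sum:
  assumes "finite I" "\<And>i. i \<in> I \<Longrightarrow> laurent_polynomial (f i)"
  shows "laurent_polynomial (sum f I)" "laurent_eval (sum f I) z = (\<Sum>i\<in>I. laurent_eval (f i) z)"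
proof -
  have zero: "laurent_polynomial 0" "laurent_eval 0 z = 0"
    by (simp_all add: laurent_polynomial_def laurent_eval_def)
  have "laurent_polynomial (sum f I) \<and> laurent_eval (sum f I) z = (\<Sum>i\<in>I. laurent_eval (f i) z)"
    using assms by (induction I rule: finite_induct) (simp_all add: zero laurent_polynomial_add)
  then show "laurent_polynomial (sum f I)" "laurent_eval (sum f I) z = (\<Sum>i\<in>I. laurent_eval (f i) z)"
    by simp_all
qed

lemma laurent_polynomial_expand:
  assumes "laurent_polynomial f"
  shows "f = (\<Sum>n | fls_nth f n \<noteq> 0. laurent_monomial (fls_nth f n) n)"
proof (rule fls_eqI)
  fix m
  let ?S = "{n. fls_nth f n \<noteq> 0}"
  have "finite ?S" using assms by (simp add: laurent_polynomial_def)
  then show "fls_nth f m = fls_nth (\<Sum>n\<in>?S. laurent_monomial (fls_nth f n) n) m"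
    by (simp add: fls_nth_sum laurent_monomial_nth)
qed

lemma laurent_monomial_mult:
  "laurent_monomial c m * laurent_monomial d n = laurent_monomial (c * d) (m + n)"
proof -
  have "laurent_monomial c m * laurent_monomial d n =
    fls_const (c * d) * (fls_X_intpow m * fls_X_intpow n)"
    by (simp add: laurent_monomial_def ac_simps flip: fls_const_mult_const)
  then show ?thesis by (simp add: laurent_monomial_def fls_X_intpow_times_fls_X_intpow)
qed

text \<open>Evaluation is multiplicative on monomials, and a Laurent polynomial is the sum of its monomials.\<close>

lemma laurent_polynomial_mult:
  assumes "laurent_polynomial f" "laurent_polynomial g"
  shows "laurent_polynomial (f * g)"
    and "z \<noteq> 0 \<Longrightarrow> laurent_eval (f * g) z = laurent_eval f z * laurent_eval g z"
proof -
  let ?S = "{n. fls_nth f n \<noteq> 0}" and ?T = "{n. fls_nth g n \<noteq> 0}"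
  have fin: "finite ?S" "finite ?T" using assms by (simp_all add: laurent_polynomial_def)
  have fg: "f * g = (\<Sum>m\<in>?S. \<Sum>n\<in>?T. laurent_monomial (fls_nth f m * fls_nth g n) (m + n))"
    by (subst laurent_polynomial_expand[OF assms(1)], subst laurent_polynomial_expand[OF assms(2)])
      (simp add: sum_product laurent_monomial_mult)
  show "laurent_polynomial (f * g)"
    unfolding fg by (intro laurent_polynomial_sum fin laurent_monomial)
  assume "z \<noteq> 0"
  then show "laurent_eval (f * g) z = laurent_eval f z * laurent_eval g z"
    unfolding fg laurent_eval_def[of f] laurent_eval_def[of g] sum_product
    by (simp add: laurent_polynomial_sum fin laurent_monomial power_int_add ac_simps)
qed

lemma laurent_polynomial_deriv: "laurent_polynomial f \<Longrightarrow> laurent_polynomial (fls_deriv f)"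
proof -
  assume f: "laurent_polynomial f"
  have "{n. fls_nth (fls_deriv f) n \<noteq> 0} \<subseteq> (\<lambda>n. n - 1) ` {n. fls_nth f n \<noteq> 0}"
    by (auto simp: image_iff intro!: exI[of _ "_ + 1"])
  then show ?thesis using f finite_surj unfolding laurent_polynomial_def by blast
qed

lemma laurent_polynomial_derivs: "laurent_polynomial f \<Longrightarrow> laurent_polynomial ((fls_deriv ^^ k) f)"
  by (induction k) (simp_all add: laurent_polynomial_deriv)

lemma laurent_polynomial_prod:
  assumes "\<And>i. i \<in> I \<Longrightarrow> laurent_polynomial (f i)"
  shows "laurent_polynomial (prod f I)"
    and "z \<noteq> 0 \<Longrightarrow> laurent_eval (prod f I) z = (\<Prod>i\<in>I. laurent_eval (f i) z)"
proof -
  have one: "laurent_polynomial 1" "laurent_eval 1 z = 1"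
    using laurent_monomial(1)[of 1 0] laurent_monomial(2)[of 1 0 z] by (simp_all add: laurent_monomial_def)
  have "laurent_polynomial (prod f I) \<and> (z \<noteq> 0 \<longrightarrow> laurent_eval (prod f I) z = (\<Prod>i\<in>I. laurent_eval (f i) z))"
    using assms by (induction I rule: infinite_finite_induct) (simp_all add: one laurent_polynomial_mult)
  then show "laurent_polynomial (prod f I)"
    and "z \<noteq> 0 \<Longrightarrow> laurent_eval (prod f I) z = (\<Prod>i\<in>I. laurent_eval (f i) z)"
    by simp_all
qed

lemma fls_derivs_add: "(fls_deriv ^^ k) (f + g) = (fls_deriv ^^ k) f + (fls_deriv ^^ k) g"
  by (induction k arbitrary: f g) (simp_all del: funpow.simps add: funpow_Suc_right)

text \<open>The lowest-order term in the Leibniz rule: if \<open>g\<close> vanishes at \<open>z\<close> to order at least \<open>m\<close>, then every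
term of the \<open>m\<close>-th derivative of \<open>h g\<close> that differentiates \<open>h\<close> vanishes.\<close>

lemma laurent_eval_derivs_mult:
  assumes z: "z \<noteq> 0"
  shows "laurent_polynomial h \<Longrightarrow> laurent_polynomial g \<Longrightarrow>
      (\<And>k. k < m \<Longrightarrow> laurent_eval ((fls_deriv ^^ k) g) z = 0) \<Longrightarrow>
    laurent_eval ((fls_deriv ^^ m) (h * g)) z = laurent_eval h z * laurent_eval ((fls_deriv ^^ m) g) z"
proof (induction m arbitrary: h g)
  case 0
  then show ?case using z by (simp add: laurent_polynomial_mult)
next
  case (Suc m)
  have pol: "laurent_polynomial (fls_deriv h)" "laurent_polynomial (fls_deriv g)"
    using Suc.prems laurent_polynomial_deriv by blast+
  have "laurent_eval ((fls_deriv ^^ k) (fls_deriv g)) z = 0" if "k < m" for k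
    using Suc.prems(3)[of "Suc k"] that by (simp add: funpow_swap1)
  then have 1: "laurent_eval ((fls_deriv ^^ m) (h * fls_deriv g)) z =
      laurent_eval h z * laurent_eval ((fls_deriv ^^ m) (fls_deriv g)) z"
    by (rule Suc.IH[OF Suc.prems(1) pol(2)])
  have "laurent_eval ((fls_deriv ^^ m) (fls_deriv h * g)) z =
      laurent_eval (fls_deriv h) z * laurent_eval ((fls_deriv ^^ m) g) z"
    by (rule Suc.IH[OF pol(1) Suc.prems(2)]) (simp add: Suc.prems(3))
  then have 2: "laurent_eval ((fls_deriv ^^ m) (fls_deriv h * g)) z = 0"
    using Suc.prems(3)[of m] by simp
  have "(fls_deriv ^^ Suc m) (h * g) = (fls_deriv ^^ m) (h * fls_deriv g) + (fls_deriv ^^ m) (fls_deriv h * g)"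
    by (simp add: funpow_Suc_right fls_derivs_add del: funpow.simps)
  then show ?case
    using 1 2 by (simp add: laurent_polynomial_add laurent_polynomial_derivs laurent_polynomial_mult
        Suc.prems(1,2) pol funpow_swap1)
qed

text \<open>If moreover \<open>h\<close> vanishes at \<open>z\<close>, the Leibniz rule for the next derivative keeps only the terms in which
\<open>h\<close> is differentiated exactly once, and there are \<open>Suc m\<close> of them.\<close>

lemma laurent_eval_derivs_mult_zero:
  assumes z: "z \<noteq> 0"
  shows "laurent_polynomial h \<Longrightarrow> laurent_polynomial g \<Longrightarrow> laurent_eval h z = 0 \<Longrightarrow>
      (\<And>k. k < m \<Longrightarrow> laurent_eval ((fls_deriv ^^ k) g) z = 0) \<Longrightarrow>
    laurent_eval ((fls_deriv ^^ Suc m) (h * g)) z =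
      of_nat (Suc m) * laurent_eval (fls_deriv h) z * laurent_eval ((fls_deriv ^^ m) g) z"
proof (induction m arbitrary: g)
  case 0
  have "laurent_polynomial (fls_deriv h)" "laurent_polynomial (fls_deriv g)"
    using 0 laurent_polynomial_deriv by blast+
  then show ?case using 0 z by (simp add: laurent_polynomial_mult laurent_polynomial_add)
next
  case (Suc m)
  have pol: "laurent_polynomial (fls_deriv h)" "laurent_polynomial (fls_deriv g)"
    using Suc.prems laurent_polynomial_deriv by blast+
  have "laurent_eval ((fls_deriv ^^ k) (fls_deriv g)) z = 0" if "k < m" for k
    using Suc.prems(4)[of "Suc k"] that by (simp add: funpow_swap1)
  then have 1: "laurent_eval ((fls_deriv ^^ Suc m) (h * fls_deriv g)) z =
      of_nat (Suc m) * laurent_eval (fls_deriv h) z * laurent_eval ((fls_deriv ^^ m) (fls_deriv g)) z"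
    by (rule Suc.IH[OF Suc.prems(1) pol(2) Suc.prems(3)])
  have 2: "laurent_eval ((fls_deriv ^^ Suc m) (fls_deriv h * g)) z =
      laurent_eval (fls_deriv h) z * laurent_eval ((fls_deriv ^^ Suc m) g) z"
    by (rule laurent_eval_derivs_mult[OF z pol(1) Suc.prems(2,4)])
  have "(fls_deriv ^^ Suc (Suc m)) (h * g) =
      (fls_deriv ^^ Suc m) (h * fls_deriv g) + (fls_deriv ^^ Suc m) (fls_deriv h * g)"
    by (subst funpow_Suc_right) (simp add: fls_derivs_add del: funpow.simps)
  then have "laurent_eval ((fls_deriv ^^ Suc (Suc m)) (h * g)) z =
      laurent_eval ((fls_deriv ^^ Suc m) (h * fls_deriv g)) z +
      laurent_eval ((fls_deriv ^^ Suc m) (fls_deriv h * g)) z"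
    by (simp only: laurent_polynomial_add laurent_polynomial_derivs laurent_polynomial_mult
        Suc.prems(1,2) pol)
  moreover have "(fls_deriv ^^ m) (fls_deriv g) = (fls_deriv ^^ Suc m) g" by (simp add: funpow_swap1)
  ultimately show ?case unfolding 1 2 by (simp add: algebra_simps del: funpow.simps)
qed

text \<open>Adding one vanishing factor at a time, the order of vanishing grows by one and the leading coefficient
is multiplied by the derivative of that factor; the integers collected on the way make up the factorial.
The induction needs both the vanishing of the lower derivatives and the value of the first possibly
nonzero one.\<close>

lemma laurent_eval_derivs_prod:
  assumes z: "z \<noteq> 0" and fin: "finite I" and g: "laurent_polynomial g"
    and f: "\<And>i. i \<in> I \<Longrightarrow> laurent_polynomial (f i)" "\<And>i. i \<in> I \<Longrightarrow> laurent_eval (f i) z = 0"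
  shows "laurent_eval ((fls_deriv ^^ card I) (prod f I * g)) z =
    fact (card I) * (\<Prod>i\<in>I. laurent_eval (fls_deriv (f i)) z) * laurent_eval g z"
proof -
  have "(\<forall>k < card I. laurent_eval ((fls_deriv ^^ k) (prod f I * g)) z = 0) \<and>
    laurent_eval ((fls_deriv ^^ card I) (prod f I * g)) z =
      fact (card I) * (\<Prod>i\<in>I. laurent_eval (fls_deriv (f i)) z) * laurent_eval g z"
    using fin f
  proof (induction I rule: finite_induct)
    case empty
    then show ?case by simp
  next
    case (insert i I)
    let ?G = "prod f I * g"
    have G: "laurent_polynomial ?G"
      using insert.prems(1) g by (intro laurent_polynomial_mult laurent_polynomial_prod) auto
    have fi: "laurent_polynomial (f i)" "laurent_eval (f i) z = 0" using insert.prems by auto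
    have IH: "\<And>k. k < card I \<Longrightarrow> laurent_eval ((fls_deriv ^^ k) ?G) z = 0"
      "laurent_eval ((fls_deriv ^^ card I) ?G) z =
        fact (card I) * (\<Prod>i\<in>I. laurent_eval (fls_deriv (f i)) z) * laurent_eval g z"
      using insert by auto
    have e: "prod f (insert i I) * g = f i * ?G" using insert(1,2) by (simp add: ac_simps)
    have "laurent_eval ((fls_deriv ^^ k) (f i * ?G)) z = 0" if "k < Suc (card I)" for k
      using laurent_eval_derivs_mult[OF z fi(1) G, of k] IH(1) that fi(2) by simp
    moreover have "laurent_eval ((fls_deriv ^^ Suc (card I)) (f i * ?G)) z =
      of_nat (Suc (card I)) * laurent_eval (fls_deriv (f i)) z * laurent_eval ((fls_deriv ^^ card I) ?G) z"
      by (rule laurent_eval_derivs_mult_zero[OF z fi(1) G fi(2) IH(1)])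
    ultimately show ?case unfolding e using insert(1,2) by (simp add: IH(2) del: funpow.simps of_nat_Suc)
  qed
  then show ?thesis by blast
qed

lemma laurent_quantum_factor:
  shows "laurent_polynomial (fls_X_intpow n - fls_X_intpow (- n))"
    and "laurent_eval (fls_X_intpow n - fls_X_intpow (- n)) z = z powi n - z powi (- n)"
    and "z \<noteq> 0 \<Longrightarrow> laurent_eval (fls_deriv (fls_X_intpow n - fls_X_intpow (- n))) z =
      of_int n * (z powi n + z powi (- n)) * inverse z"
proof -
  have e: "fls_X_intpow n - fls_X_intpow (- n) = laurent_monomial 1 n + laurent_monomial (- 1) (- n)"
    by (rule fls_eqI) (simp add: laurent_monomial_nth)
  have d: "fls_deriv (laurent_monomial c m) = laurent_monomial (of_int m * c) (m - 1)" for c m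
    by (rule fls_eqI) (auto simp: laurent_monomial_nth)
  show "laurent_polynomial (fls_X_intpow n - fls_X_intpow (- n))"
    "laurent_eval (fls_X_intpow n - fls_X_intpow (- n)) z = z powi n - z powi (- n)"
    unfolding e by (simp_all add: laurent_polynomial_add laurent_monomial)
  have "laurent_eval (fls_deriv (fls_X_intpow n - fls_X_intpow (- n))) z =
      of_int n * z powi (n - 1) + of_int n * z powi (- n - 1)"
    unfolding e by (simp add: d laurent_polynomial_add laurent_monomial)
  moreover assume "z \<noteq> 0"
  ultimately show "laurent_eval (fls_deriv (fls_X_intpow n - fls_X_intpow (- n))) z =
      of_int n * (z powi n + z powi (- n)) * inverse z"
    using power_int_diff[of z n 1] power_int_diff[of z "- n" 1] by (simp add: field_simps)
qed

section \<open>Roots of unity\<close>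

lemma primitive_root_powi_eq_1:
  assumes "primitive_root_of_unity n z" "z powi k = 1"
  shows "int n dvd k"
proof -
  have n: "n > 0" "z ^ n = 1" and min: "\<And>j. 0 < j \<Longrightarrow> j < n \<Longrightarrow> z ^ j \<noteq> 1"
    using assms(1) unfolding primitive_root_of_unity_def by auto
  have z: "z \<noteq> 0" using n by (metis power_0_left zero_neq_one not_gr_zero)
  define r where "r = nat (k mod int n)"
  have r: "int r = k mod int n" "r < n" using n(1) by (simp_all add: r_def nat_less_iff)
  have "k = int n * (k div int n) + int r" by (simp add: r(1))
  then have "z powi k = (z powi int n) powi (k div int n) * z powi int r"
    using z by (metis power_int_add power_int_mult)
  then have "z ^ r = 1" using assms(2) n(2) by simp
  then have "r = 0" using min[of r] r(2) by force
  then show ?thesis using r(1) by (simp add: dvd_eq_mod_eq_0)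
qed

lemma primitive_root_powi_mult:
  assumes "primitive_root_of_unity n z" shows "z powi (int n * k) = 1"
proof -
  have "z ^ n = 1" using assms unfolding primitive_root_of_unity_def by auto
  then show ?thesis by (simp add: power_int_mult)
qed

section \<open>Reflections and coroots\<close>

lemma inner_coroot: "x \<bullet> coroot \<alpha> = 2 * (x \<bullet> \<alpha>) / (\<alpha> \<bullet> \<alpha>)"
  by (simp add: coroot_def)

lemma coroot_minus [simp]: "coroot (- \<alpha>) = - coroot \<alpha>"
  by (simp add: coroot_def)

lemma self_inner_coroot [simp]: "\<alpha> \<noteq> 0 \<Longrightarrow> \<alpha> \<bullet> coroot \<alpha> = 2"
  by (simp add: inner_coroot)

lemma inner_coroot_sign:
  assumes "\<alpha> \<noteq> 0"
  shows "x \<bullet> coroot \<alpha> > 0 \<longleftrightarrow> x \<bullet> \<alpha> > 0" "x \<bullet> coroot \<alpha> \<ge> 0 \<longleftrightarrow> x \<bullet> \<alpha> \<ge> 0"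
    "x \<bullet> coroot \<alpha> = 0 \<longleftrightarrow> x \<bullet> \<alpha> = 0"
proof -
  have "\<alpha> \<bullet> \<alpha> > 0" using assms by simp
  then show "x \<bullet> coroot \<alpha> > 0 \<longleftrightarrow> x \<bullet> \<alpha> > 0" "x \<bullet> coroot \<alpha> \<ge> 0 \<longleftrightarrow> x \<bullet> \<alpha> \<ge> 0"
    "x \<bullet> coroot \<alpha> = 0 \<longleftrightarrow> x \<bullet> \<alpha> = 0"
    by (simp_all add: inner_coroot pos_less_divide_eq pos_le_divide_eq)
qed

lemma linear_root_reflection: "linear (root_reflection \<alpha>)"
  unfolding root_reflection_def
  by (rule linearI) (auto simp: inner_add_left algebra_simps)

lemma root_reflection_minus [simp]:
  "root_reflection (- \<alpha>) = root_reflection \<alpha>"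
  "root_reflection \<alpha> (- x) = - root_reflection \<alpha> x"
  by (auto simp: root_reflection_def fun_eq_iff)

lemma root_reflection_self: "\<alpha> \<noteq> 0 \<Longrightarrow> root_reflection \<alpha> \<alpha> = - \<alpha>"
  by (simp add: root_reflection_def scaleR_2)

lemma root_reflection_involution [simp]:
  "root_reflection \<alpha> (root_reflection \<alpha> x) = x"
  by (cases "\<alpha> = 0") (auto simp: root_reflection_def inner_diff_left algebra_simps)

lemma inner_root_reflection_left: "root_reflection \<alpha> x \<bullet> y = x \<bullet> root_reflection \<alpha> y"
  by (simp add: root_reflection_def inner_coroot inner_diff_left inner_diff_right inner_commute)

lemma inner_root_reflection [simp]: "root_reflection \<alpha> x \<bullet> root_reflection \<alpha> y = x \<bullet> y"
  by (simp add: inner_root_reflection_left)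

lemma coroot_root_reflection: "coroot (root_reflection \<alpha> \<beta>) = root_reflection \<alpha> (coroot \<beta>)"
  by (simp add: coroot_def linear_cmul[OF linear_root_reflection])

lemma inner_coroot_root_reflection:
  "x \<bullet> coroot (root_reflection \<alpha> \<beta>) = root_reflection \<alpha> x \<bullet> coroot \<beta>"
  by (simp add: coroot_root_reflection inner_root_reflection_left)

lemma root_reflection_conjugate:
  "root_reflection (root_reflection \<alpha> \<beta>) x =
   root_reflection \<alpha> (root_reflection \<beta> (root_reflection \<alpha> x))"
proof -
  have "root_reflection \<alpha> (root_reflection \<beta> (root_reflection \<alpha> x)) =
     root_reflection \<alpha> (root_reflection \<alpha> x) - (root_reflection \<alpha> x \<bullet> coroot \<beta>) *\<^sub>R root_reflection \<alpha> \<beta>"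
    by (simp add: root_reflection_def[of \<beta>] linear_diff[OF linear_root_reflection]
        linear_cmul[OF linear_root_reflection])
  then show ?thesis
    by (simp add: inner_coroot_root_reflection root_reflection_def[of "root_reflection \<alpha> \<beta>"])
qed

section \<open>Root systems with a basis\<close>

text \<open>Coordinates with respect to the basis of simple roots carry the combinatorics: the coordinates of a
root all have the same sign, so a single positive coordinate makes it positive.\<close>

locale based_root_system =
  fixes \<Phi> \<Delta> :: "'a::euclidean_space set"
  assumes root_system: "root_system \<Phi>" and simple_roots: "simple_roots \<Phi> \<Delta>"
begin

abbreviation "P \<equiv> pos_roots \<Phi> \<Delta>"
abbreviation "\<rho> \<equiv> rho \<Phi> \<Delta>"
abbreviation "\<sigma> \<equiv> root_reflection"
abbreviation "coord \<delta> x \<equiv> representation \<Delta> x \<delta>"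

lemma finite_roots: "finite \<Phi>"
  and zero_not_root: "0 \<notin> \<Phi>"
  and refl_image: "\<alpha> \<in> \<Phi> \<Longrightarrow> \<sigma> \<alpha> ` \<Phi> = \<Phi>"
  and cartan_int: "\<alpha> \<in> \<Phi> \<Longrightarrow> \<beta> \<in> \<Phi> \<Longrightarrow> \<beta> \<bullet> coroot \<alpha> \<in> \<int>"
  and reduced: "\<alpha> \<in> \<Phi> \<Longrightarrow> c *\<^sub>R \<alpha> \<in> \<Phi> \<Longrightarrow> c = 1 \<or> c = - 1"
  using root_system unfolding root_system_def by auto

lemma root_nonzero: "\<alpha> \<in> \<Phi> \<Longrightarrow> \<alpha> \<noteq> 0"
  using zero_not_root by auto

lemma root_sq_pos: "\<alpha> \<in> \<Phi> \<Longrightarrow> \<alpha> \<bullet> \<alpha> > 0"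
  using root_nonzero by auto

lemma refl_root: "\<alpha> \<in> \<Phi> \<Longrightarrow> \<beta> \<in> \<Phi> \<Longrightarrow> \<sigma> \<alpha> \<beta> \<in> \<Phi>"
  using refl_image by blast

lemma minus_root: "\<alpha> \<in> \<Phi> \<Longrightarrow> - \<alpha> \<in> \<Phi>"
  using refl_root[of \<alpha> \<alpha>] root_reflection_self root_nonzero by metis

lemma minus_root_iff [simp]: "- \<alpha> \<in> \<Phi> \<longleftrightarrow> \<alpha> \<in> \<Phi>"
  using minus_root[of \<alpha>] minus_root[of "- \<alpha>"] by auto

lemma simple_subset: "\<Delta> \<subseteq> \<Phi>"
  and indep: "independent \<Delta>"
  and span_simple: "span \<Delta> = UNIV"
  using simple_roots unfolding simple_roots_def by auto

lemma simple_root: "\<delta> \<in> \<Delta> \<Longrightarrow> \<delta> \<in> \<Phi>"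
  using simple_subset by auto

lemma finite_simple: "finite \<Delta>"
  using finite_subset[OF simple_subset finite_roots] .

lemma coord_expand: "(\<Sum>\<delta>\<in>\<Delta>. coord \<delta> x *\<^sub>R \<delta>) = x"
  using real_vector.sum_representation_eq[OF indep _ finite_simple order_refl] span_simple by auto

lemma coord_unique:
  assumes "x = (\<Sum>\<delta>\<in>\<Delta>. c \<delta> *\<^sub>R \<delta>)" "\<delta> \<in> \<Delta>"
  shows "coord \<delta> x = c \<delta>"
proof -
  have "(\<Sum>\<delta>\<in>\<Delta>. (coord \<delta> x - c \<delta>) *\<^sub>R \<delta>) = 0"
    using assms(1) coord_expand[of x] by (simp add: scaleR_diff_left sum_subtractf)
  then have "coord \<delta> x - c \<delta> = 0"
    using indep assms(2) finite_simple unfolding independent_explicit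
    by (elim conjE allE[of _ "\<lambda>\<delta>. coord \<delta> x - c \<delta>"]) auto
  then show ?thesis by simp
qed

lemma coord_diff: "coord \<delta> (x - y) = coord \<delta> x - coord \<delta> y"
  using real_vector.representation_diff[OF indep] span_simple by simp

lemma coord_add: "coord \<delta> (x + y) = coord \<delta> x + coord \<delta> y"
  using real_vector.representation_add[OF indep] span_simple by simp

lemma coord_scale: "coord \<delta> (r *\<^sub>R x) = r * coord \<delta> x"
  using real_vector.representation_scale[OF indep] span_simple by simp

lemma coord_minus: "coord \<delta> (- x) = - coord \<delta> x"
  using coord_scale[of "- 1" x \<delta>] by simp

lemma coord_simple: "\<delta> \<in> \<Delta> \<Longrightarrow> coord \<delta>' \<delta> = (if \<delta>' = \<delta> then 1 else 0)"
  using real_vector.representation_basis[OF indep, of \<delta>] by auto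

lemma inner_coord: "x \<bullet> y = (\<Sum>\<delta>\<in>\<Delta>. coord \<delta> x * (\<delta> \<bullet> y))"
proof -
  have "x \<bullet> y = (\<Sum>\<delta>\<in>\<Delta>. (coord \<delta> x) *\<^sub>R \<delta>) \<bullet> y" by (simp add: coord_expand)
  then show ?thesis by (simp add: inner_sum_left)
qed

lemma nat_cone_coord: "x \<in> nat_cone \<Delta> \<longleftrightarrow> (\<forall>\<delta>\<in>\<Delta>. coord \<delta> x \<in> \<nat>)"
proof
  assume "x \<in> nat_cone \<Delta>"
  then obtain c :: "'a \<Rightarrow> nat" where "x = (\<Sum>\<delta>\<in>\<Delta>. of_nat (c \<delta>) *\<^sub>R \<delta>)"
    unfolding nat_cone_def by blast
  then show "\<forall>\<delta>\<in>\<Delta>. coord \<delta> x \<in> \<nat>" using coord_unique[of x "\<lambda>\<delta>. of_nat (c \<delta>)"] by auto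
next
  assume "\<forall>\<delta>\<in>\<Delta>. coord \<delta> x \<in> \<nat>"
  then have "\<forall>\<delta>. \<exists>n. \<delta> \<in> \<Delta> \<longrightarrow> coord \<delta> x = of_nat n" by (auto elim: Nats_cases)
  then obtain c where c: "\<And>\<delta>. \<delta> \<in> \<Delta> \<Longrightarrow> coord \<delta> x = of_nat (c \<delta>)" by metis
  have "x = (\<Sum>\<delta>\<in>\<Delta>. of_nat (c \<delta>) *\<^sub>R \<delta>)" using coord_expand[of x] c by simp
  then show "x \<in> nat_cone \<Delta>" unfolding nat_cone_def by blast
qed

lemma pos_root_iff: "\<alpha> \<in> P \<longleftrightarrow> \<alpha> \<in> \<Phi> \<and> (\<forall>\<delta>\<in>\<Delta>. coord \<delta> \<alpha> \<ge> 0)"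
proof
  assume "\<alpha> \<in> P"
  then show "\<alpha> \<in> \<Phi> \<and> (\<forall>\<delta>\<in>\<Delta>. coord \<delta> \<alpha> \<ge> 0)"
    by (auto simp: pos_roots_def nat_cone_coord elim!: Nats_cases)
next
  assume a: "\<alpha> \<in> \<Phi> \<and> (\<forall>\<delta>\<in>\<Delta>. coord \<delta> \<alpha> \<ge> 0)"
  then obtain c :: "'a \<Rightarrow> int" where "\<alpha> = (\<Sum>\<delta>\<in>\<Delta>. of_int (c \<delta>) *\<^sub>R \<delta>)"
    using simple_roots unfolding simple_roots_def by blast
  from coord_unique[OF this] a have "\<forall>\<delta>\<in>\<Delta>. coord \<delta> \<alpha> \<in> \<nat>"
    by (auto simp: Nats_altdef1)
  then show "\<alpha> \<in> P" using a by (simp add: pos_roots_def nat_cone_coord)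
qed

lemma pos_or_neg: "\<alpha> \<in> \<Phi> \<Longrightarrow> \<alpha> \<in> P \<or> - \<alpha> \<in> P"
proof -
  assume a: "\<alpha> \<in> \<Phi>"
  then obtain c :: "'a \<Rightarrow> int" where c: "\<alpha> = (\<Sum>\<delta>\<in>\<Delta>. of_int (c \<delta>) *\<^sub>R \<delta>)"
    and "(\<forall>\<delta>\<in>\<Delta>. c \<delta> \<ge> 0) \<or> (\<forall>\<delta>\<in>\<Delta>. c \<delta> \<le> 0)"
    using simple_roots unfolding simple_roots_def by blast
  then show ?thesis using a coord_unique[OF c] by (auto simp: pos_root_iff coord_minus)
qed

lemma finite_pos: "finite P"
  using finite_roots by (simp add: pos_roots_def)

lemma pos_root: "\<alpha> \<in> P \<Longrightarrow> \<alpha> \<in> \<Phi>"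
  by (simp add: pos_roots_def)

lemma coord_pos_imp_pos:
  assumes "\<alpha> \<in> \<Phi>" "\<delta> \<in> \<Delta>" "coord \<delta> \<alpha> > 0"
  shows "\<alpha> \<in> P"
  using pos_or_neg[OF assms(1)] assms by (force simp: pos_root_iff coord_minus)

lemma coord_zero_imp: "(\<And>\<delta>. \<delta> \<in> \<Delta> \<Longrightarrow> coord \<delta> x = 0) \<Longrightarrow> x = 0"
  using coord_expand[of x] by simp

lemma neg_not_pos:
  assumes "\<alpha> \<in> P" shows "- \<alpha> \<notin> P"
proof
  assume "- \<alpha> \<in> P"
  then have "\<And>\<delta>. \<delta> \<in> \<Delta> \<Longrightarrow> coord \<delta> \<alpha> = 0"
    using assms by (force simp: pos_root_iff coord_minus)
  then show False using coord_zero_imp assms pos_root zero_not_root by metis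
qed

lemma simple_pos: "\<delta> \<in> \<Delta> \<Longrightarrow> \<delta> \<in> P"
  by (simp add: pos_root_iff simple_root coord_simple)

lemma coord_refl:
  assumes "\<delta> \<in> \<Delta>"
  shows "coord \<delta>' (\<sigma> \<delta> x) = coord \<delta>' x - (if \<delta>' = \<delta> then x \<bullet> coroot \<delta> else 0)"
  using assms by (simp add: root_reflection_def coord_diff coord_scale coord_simple)

text \<open>A positive root other than \<open>\<delta>\<close> has a positive coordinate at some further simple root, because the
only positive multiple of \<open>\<delta>\<close> among the roots is \<open>\<delta>\<close> itself. The reflection leaves that coordinate
unchanged.\<close>

lemma refl_simple_pos:
  assumes d: "\<delta> \<in> \<Delta>" and b: "\<beta> \<in> P" "\<beta> \<noteq> \<delta>"
  shows "\<sigma> \<delta> \<beta> \<in> P"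
proof -
  have "\<exists>\<delta>'\<in>\<Delta>. \<delta>' \<noteq> \<delta> \<and> coord \<delta>' \<beta> > 0"
  proof (rule ccontr)
    assume "\<not> ?thesis"
    then have z: "\<And>\<delta>'. \<delta>' \<in> \<Delta> \<Longrightarrow> \<delta>' \<noteq> \<delta> \<Longrightarrow> coord \<delta>' \<beta> = 0"
      using b(1) by (force simp: pos_root_iff)
    have "\<beta> = (\<Sum>\<delta>'\<in>\<Delta>. if \<delta>' = \<delta> then coord \<delta> \<beta> *\<^sub>R \<delta> else 0)"
      by (subst (1) coord_expand[of \<beta>, symmetric], rule sum.cong) (auto simp: z)
    then have e: "\<beta> = coord \<delta> \<beta> *\<^sub>R \<delta>" using d finite_simple by simp
    then have "coord \<delta> \<beta> = 1 \<or> coord \<delta> \<beta> = -1"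
      using reduced[OF simple_root[OF d], of "coord \<delta> \<beta>"] pos_root[OF b(1)] by simp
    then have "coord \<delta> \<beta> = 1" using b(1) d by (force simp: pos_root_iff)
    then show False using e b(2) by simp
  qed
  then obtain \<delta>' where "\<delta>' \<in> \<Delta>" "\<delta>' \<noteq> \<delta>" "coord \<delta>' \<beta> > 0" by blast
  then show ?thesis using coord_pos_imp_pos[of "\<sigma> \<delta> \<beta>" \<delta>'] coord_refl[OF d]
      refl_root[OF simple_root[OF d] pos_root[OF b(1)]] by simp
qed

lemma refl_simple_perm:
  assumes d: "\<delta> \<in> \<Delta>"
  shows "bij_betw (\<sigma> \<delta>) (P - {\<delta>}) (P - {\<delta>})"
proof (rule bij_betw_byWitness[where f' = "\<sigma> \<delta>"])
  have "\<sigma> \<delta> \<beta> \<noteq> \<delta>" if "\<beta> \<in> P" for \<beta>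
  proof
    assume "\<sigma> \<delta> \<beta> = \<delta>"
    then have "\<beta> = - \<delta>" by (metis root_reflection_involution root_reflection_self
          root_nonzero[OF simple_root[OF d]])
    then show False using neg_not_pos[OF that] simple_pos[OF d] by simp
  qed
  then show "\<sigma> \<delta> ` (P - {\<delta>}) \<subseteq> P - {\<delta>}" "\<sigma> \<delta> ` (P - {\<delta>}) \<subseteq> P - {\<delta>}"
    using refl_simple_pos[OF d] by auto
qed auto

text \<open>In twice \<open>\<rho>\<close> the reflection permutes all summands except \<open>\<delta>\<close>, whose sign it reverses.\<close>

lemma refl_simple_rho:
  assumes d: "\<delta> \<in> \<Delta>"
  shows "\<sigma> \<delta> \<rho> = \<rho> - \<delta>"
proof -
  let ?S = "\<Sum>\<beta>\<in>P - {\<delta>}. \<beta>"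
  have r: "\<rho> = (1/2) *\<^sub>R (\<delta> + ?S)"
    unfolding rho_def using sum.remove[OF finite_pos simple_pos[OF d], of "\<lambda>x. x"] by simp
  have "\<sigma> \<delta> ?S = (\<Sum>\<beta>\<in>P - {\<delta>}. \<sigma> \<delta> \<beta>)" by (rule linear_sum[OF linear_root_reflection])
  also have "\<dots> = ?S" by (rule sum.reindex_bij_betw[OF refl_simple_perm[OF d]])
  finally have "\<sigma> \<delta> \<rho> = (1/2) *\<^sub>R (- \<delta> + ?S)"
    unfolding r using root_reflection_self[OF root_nonzero[OF simple_root[OF d]]]
    by (simp add: linear_cmul[OF linear_root_reflection] linear_add[OF linear_root_reflection])
  also have "\<dots> = \<rho> - \<delta>" unfolding r
    by (simp add: algebra_simps flip: scaleR_add_left)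
  finally show ?thesis .
qed

lemma rho_simple:
  assumes d: "\<delta> \<in> \<Delta>" shows "\<rho> \<bullet> coroot \<delta> = 1"
proof -
  have "(\<rho> \<bullet> coroot \<delta>) *\<^sub>R \<delta> = 1 *\<^sub>R \<delta>"
    using refl_simple_rho[OF d] by (simp add: root_reflection_def)
  then show ?thesis using root_nonzero[OF simple_root[OF d]] by (metis scaleR_cancel_right)
qed

lemma inner_pos_root_pos:
  assumes "\<And>\<delta>. \<delta> \<in> \<Delta> \<Longrightarrow> v \<bullet> \<delta> > 0" "\<beta> \<in> P"
  shows "v \<bullet> \<beta> > 0"
proof -
  have nn: "\<And>\<delta>. \<delta> \<in> \<Delta> \<Longrightarrow> coord \<delta> \<beta> \<ge> 0" using assms(2) by (simp add: pos_root_iff)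
  obtain \<delta> where "\<delta> \<in> \<Delta>" "coord \<delta> \<beta> \<noteq> 0"
    using coord_zero_imp[of \<beta>] root_nonzero[OF pos_root[OF assms(2)]] by blast
  with nn have d: "\<delta> \<in> \<Delta>" "coord \<delta> \<beta> > 0" by force+
  have "\<beta> \<bullet> v = (\<Sum>\<delta>\<in>\<Delta>. coord \<delta> \<beta> * (\<delta> \<bullet> v))" by (rule inner_coord)
  also have "\<dots> > 0"
    using d nn assms(1) finite_simple
    by (intro sum_pos2[of _ \<delta>]) (auto simp: inner_commute less_imp_le)
  finally show ?thesis by (simp add: inner_commute)
qed

lemma inner_pos_root_nonneg:
  assumes "\<And>\<delta>. \<delta> \<in> \<Delta> \<Longrightarrow> v \<bullet> \<delta> \<ge> 0" "\<beta> \<in> P"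
  shows "v \<bullet> \<beta> \<ge> 0"
proof -
  have "\<beta> \<bullet> v = (\<Sum>\<delta>\<in>\<Delta>. coord \<delta> \<beta> * (\<delta> \<bullet> v))" by (rule inner_coord)
  also have "\<dots> \<ge> 0"
    using assms by (intro sum_nonneg) (auto simp: inner_commute pos_root_iff)
  finally show ?thesis by (simp add: inner_commute)
qed

lemma rho_simple_pos: "\<delta> \<in> \<Delta> \<Longrightarrow> \<rho> \<bullet> \<delta> > 0"
  using rho_simple[of \<delta>] inner_coroot_sign(1)[OF root_nonzero[OF simple_root], of \<delta> \<rho>] by simp

lemma rho_pos_root: "\<beta> \<in> P \<Longrightarrow> \<rho> \<bullet> \<beta> > 0"
  using inner_pos_root_pos rho_simple_pos by blast

lemma pos_root_simple_acute:
  assumes "\<beta> \<in> P" obtains \<delta> where "\<delta> \<in> \<Delta>" "\<beta> \<bullet> \<delta> > 0"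
proof (rule ccontr)
  assume "\<not> thesis"
  then have "\<And>\<delta>. \<delta> \<in> \<Delta> \<Longrightarrow> (- \<beta>) \<bullet> \<delta> \<ge> 0" using that by force
  from inner_pos_root_nonneg[OF this assms] have "(- \<beta>) \<bullet> \<beta> \<ge> 0" by simp
  then show False using root_sq_pos[OF pos_root[OF assms]] by simp
qed

lemma inner_refl_simple: "x \<bullet> \<sigma> \<delta> y = x \<bullet> y - (y \<bullet> coroot \<delta>) * (x \<bullet> \<delta>)"
  by (simp add: root_reflection_def inner_diff_right)

text \<open>Every positive root arises from a simple one by simple reflections through positive roots: a positive
root that is not simple makes an acute angle with some simple root, and the reflection in it lowers the
pairing with \<open>\<rho>\<close>. As there are finitely many roots, a counterexample with least pairing would exist.\<close>

lemma pos_root_induct [consumes 1, case_names simple reflect]: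
  assumes "\<beta> \<in> P"
    and base: "\<And>\<delta>. \<delta> \<in> \<Delta> \<Longrightarrow> Q \<delta>"
    and step: "\<And>\<delta> \<beta>. \<lbrakk>\<delta> \<in> \<Delta>; \<beta> \<in> P; \<sigma> \<delta> \<beta> \<in> P; Q \<beta>\<rbrakk> \<Longrightarrow> Q (\<sigma> \<delta> \<beta>)"
  shows "Q \<beta>"
proof (rule ccontr)
  assume "\<not> Q \<beta>"
  let ?B = "{\<beta>\<in>P. \<not> Q \<beta>}"
  have "finite ?B" "?B \<noteq> {}" using finite_pos assms(1) \<open>\<not> Q \<beta>\<close> by auto
  then obtain \<gamma> where g: "\<gamma> \<in> P" "\<not> Q \<gamma>" and min: "\<And>\<beta>. \<beta> \<in> P \<Longrightarrow> \<not> Q \<beta> \<Longrightarrow> \<rho> \<bullet> \<gamma> \<le> \<rho> \<bullet> \<beta>"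
    using ex_is_arg_min_if_finite[of ?B "\<lambda>\<beta>. \<rho> \<bullet> \<beta>"] by (auto simp: is_arg_min_def not_less)
  obtain \<delta> where d: "\<delta> \<in> \<Delta>" "\<gamma> \<bullet> \<delta> > 0" using pos_root_simple_acute[OF g(1)] .
  have "\<gamma> \<noteq> \<delta>" using base d g by auto
  then have p: "\<sigma> \<delta> \<gamma> \<in> P" using refl_simple_pos d g by blast
  have "\<rho> \<bullet> \<sigma> \<delta> \<gamma> < \<rho> \<bullet> \<gamma>"
    using rho_simple_pos[OF d(1)] d inner_coroot_sign(1)[OF root_nonzero[OF simple_root[OF d(1)]], of \<gamma>]
    by (simp add: inner_refl_simple)
  then have "Q (\<sigma> \<delta> \<gamma>)" using min p by force
  then show False using step[OF d(1) p] g by simp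
qed

lemma rho_weight:
  assumes "\<alpha> \<in> \<Phi>" shows "\<rho> \<bullet> coroot \<alpha> \<in> \<int>"
proof -
  have *: "\<rho> \<bullet> coroot \<beta> \<in> \<int>" if "\<beta> \<in> P" for \<beta>
    using that
  proof (induction rule: pos_root_induct)
    case (simple \<delta>) then show ?case by (simp add: rho_simple)
  next
    case (reflect \<delta> \<beta>)
    then show ?case using cartan_int[OF pos_root simple_root, of \<beta> \<delta>]
      by (simp add: inner_coroot_root_reflection refl_simple_rho inner_diff_left)
  qed
  show ?thesis using pos_or_neg[OF assms] *[of \<alpha>] *[of "- \<alpha>"] by auto
qed

lemma simple_obtuse:
  assumes "\<delta> \<in> \<Delta>" "\<delta>' \<in> \<Delta>" "\<delta> \<noteq> \<delta>'" shows "\<delta> \<bullet> \<delta>' \<le> 0"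
proof -
  have "\<sigma> \<delta> \<delta>' \<in> P" using refl_simple_pos simple_pos assms by auto
  then have "coord \<delta> (\<sigma> \<delta> \<delta>') \<ge> 0" using assms by (simp add: pos_root_iff)
  then have "\<delta>' \<bullet> coroot \<delta> \<le> 0" using assms by (simp add: coord_refl coord_simple)
  then show ?thesis using inner_coroot_sign(1)[OF root_nonzero[OF simple_root[OF assms(1)]], of \<delta>']
    by (simp add: inner_commute not_less[symmetric])
qed

subsection \<open>Signs of permutations of the roots\<close>

text \<open>Replacing \<open>y \<alpha>\<close> by its positive multiple \<open>\<plusminus>y \<alpha>\<close> maps the positive roots of \<open>X\<close> bijectively onto those of
the image of \<open>X\<close>; an odd function picks up one sign for each \<open>\<alpha>\<close> at which the opposite is taken.\<close>

lemma prod_odd_function: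
  fixes g :: "'a \<Rightarrow> 'b::comm_ring_1"
  assumes X: "X \<subseteq> \<Phi>" and inj: "inj_on y X" and Y: "y ` X \<subseteq> \<Phi>"
    and symX: "\<And>\<alpha>. \<alpha> \<in> X \<Longrightarrow> - \<alpha> \<in> X" and oddy: "\<And>\<alpha>. \<alpha> \<in> X \<Longrightarrow> y (- \<alpha>) = - y \<alpha>"
    and oddg: "\<And>\<beta>. \<beta> \<in> \<Phi> \<Longrightarrow> g (- \<beta>) = - g \<beta>"
  shows "(\<Prod>\<alpha>\<in>X \<inter> P. g (y \<alpha>)) =
    (- 1) ^ card {\<alpha> \<in> X \<inter> P. y \<alpha> \<notin> P} * (\<Prod>\<beta>\<in>y ` X \<inter> P. g \<beta>)"
proof -
  define a where "a \<alpha> = (if y \<alpha> \<in> P then y \<alpha> else - y \<alpha>)" for \<alpha>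
  have fin: "finite (X \<inter> P)" using finite_pos by simp
  have "bij_betw a (X \<inter> P) (y ` X \<inter> P)"
  proof (rule bij_betwI')
    fix \<alpha> \<beta> assume ab: "\<alpha> \<in> X \<inter> P" "\<beta> \<in> X \<inter> P"
    have ne: "\<beta> \<noteq> - \<alpha>" using ab neg_not_pos by auto
    have "y \<beta> \<noteq> - y \<alpha>"
    proof
      assume "y \<beta> = - y \<alpha>"
      then have "y \<beta> = y (- \<alpha>)" using oddy ab by simp
      then show False using inj_onD[OF inj] ab symX ne by blast
    qed
    moreover have "y \<alpha> = y \<beta> \<Longrightarrow> \<alpha> = \<beta>"
      using inj_onD[OF inj] ab by blast
    ultimately show "(a \<alpha> = a \<beta>) = (\<alpha> = \<beta>)"
      unfolding a_def by (metis minus_equation_iff)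
  next
    fix \<alpha> assume al: "\<alpha> \<in> X \<inter> P"
    have "y \<alpha> \<in> y ` X" "- y \<alpha> \<in> y ` X" using al symX oddy[of \<alpha>] by (metis IntD1 imageI)+
    then show "a \<alpha> \<in> y ` X \<inter> P" using pos_or_neg[of "y \<alpha>"] Y al unfolding a_def by auto
  next
    fix \<beta> assume b: "\<beta> \<in> y ` X \<inter> P"
    then obtain \<alpha> where al: "\<alpha> \<in> X" "\<beta> = y \<alpha>" by auto
    show "\<exists>\<alpha>\<in>X \<inter> P. \<beta> = a \<alpha>"
    proof (cases "\<alpha> \<in> P")
      case True then show ?thesis using al b by (auto simp: a_def)
    next
      case False
      then have "- \<alpha> \<in> P" using pos_or_neg X al by blast
      moreover have "y (- \<alpha>) \<notin> P" using oddy al neg_not_pos[of \<beta>] b by auto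
      ultimately show ?thesis using al symX oddy by (intro bexI[of _ "- \<alpha>"]) (auto simp: a_def)
    qed
  qed
  from prod.reindex_bij_betw[OF this, of g]
  have "(\<Prod>\<beta>\<in>y ` X \<inter> P. g \<beta>) = (\<Prod>\<alpha>\<in>X \<inter> P. g (a \<alpha>))" by simp
  moreover have "(\<Prod>\<alpha>\<in>X \<inter> P. g (y \<alpha>)) = (\<Prod>\<alpha>\<in>X \<inter> P. (if y \<alpha> \<in> P then 1 else - 1) * g (a \<alpha>))"
    using Y by (intro prod.cong) (auto simp: a_def oddg)
  moreover have "(\<Prod>\<alpha>\<in>X \<inter> P. (if y \<alpha> \<in> P then 1 else - 1 :: 'b)) = (- 1) ^ card {\<alpha> \<in> X \<inter> P. y \<alpha> \<notin> P}"
  proof -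
    have "{\<alpha> \<in> X \<inter> P. y \<alpha> \<notin> P} = (X \<inter> P) \<inter> {\<alpha>. y \<alpha> \<notin> P}" 
      "(X \<inter> P) \<inter> - {\<alpha>. y \<alpha> \<in> P} = (X \<inter> P) \<inter> {\<alpha>. y \<alpha> \<notin> P}" by auto
    then show ?thesis using fin by (simp add: prod.If_cases)
  qed
  ultimately show ?thesis by (simp add: prod.distrib)
qed

text \<open>A substitute for the determinant: this polynomial function transforms by the sign character of the Weyl
group and does not vanish at \<open>\<rho>\<close>.\<close>

definition alternant :: "'a \<Rightarrow> real" where
  "alternant u = (\<Prod>\<alpha>\<in>P. u \<bullet> \<alpha>)"

lemma alternant_simple_reflection:
  assumes "\<delta> \<in> \<Delta>" shows "alternant (\<sigma> \<delta> u) = - alternant u"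
proof -
  have "alternant (\<sigma> \<delta> u) = (\<sigma> \<delta> u \<bullet> \<delta>) * (\<Prod>\<alpha>\<in>P - {\<delta>}. \<sigma> \<delta> u \<bullet> \<alpha>)"
    unfolding alternant_def by (rule prod.remove[OF finite_pos simple_pos[OF assms]])
  also have "(\<Prod>\<alpha>\<in>P - {\<delta>}. \<sigma> \<delta> u \<bullet> \<alpha>) = (\<Prod>\<alpha>\<in>P - {\<delta>}. u \<bullet> \<sigma> \<delta> \<alpha>)"
    by (simp add: inner_root_reflection_left)
  also have "\<dots> = (\<Prod>\<alpha>\<in>P - {\<delta>}. u \<bullet> \<alpha>)"
    by (rule prod.reindex_bij_betw[OF refl_simple_perm[OF assms]])
  also have "\<sigma> \<delta> u \<bullet> \<delta> = - (u \<bullet> \<delta>)"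
    by (simp add: inner_root_reflection_left root_reflection_self root_nonzero simple_root assms)
  also have "- (u \<bullet> \<delta>) * (\<Prod>\<alpha>\<in>P - {\<delta>}. u \<bullet> \<alpha>) = - alternant u"
    unfolding alternant_def
    using prod.remove[OF finite_pos simple_pos[OF assms], of "\<lambda>\<alpha>. u \<bullet> \<alpha>"] by simp
  finally show ?thesis .
qed

text \<open>For a simple reflection one factor changes its sign and the others are permuted. Every reflection is
conjugate to a simple one by simple reflections.\<close>

lemma alternant_reflection:
  assumes "\<gamma> \<in> \<Phi>" shows "alternant (\<sigma> \<gamma> u) = - alternant u"
proof -
  have *: "\<forall>u. alternant (\<sigma> \<gamma> u) = - alternant u" if "\<gamma> \<in> P" for \<gamma>
    using that
    by (induction rule: pos_root_induct)
      (simp_all add: alternant_simple_reflection root_reflection_conjugate)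
  show ?thesis using pos_or_neg[OF assms] *[of \<gamma>] *[of "- \<gamma>"] by auto
qed

lemma alternant_rho: "alternant \<rho> > 0"
  unfolding alternant_def using rho_pos_root by (intro prod_pos) auto

end

section \<open>Irreducible root systems and root lengths\<close>

locale irreducible_based_root_system = based_root_system +
  fixes \<alpha>0 :: 'a
  assumes irreducible: "irreducible_root_system \<Phi>"
    and normalized: "normalized \<Phi>"
    and maximal_short: "maximal_short_root \<Phi> \<Delta> \<alpha>0"
begin

text \<open>The Dynkin diagram of an irreducible root system is connected. If \<open>A\<close> were orthogonal to its complement,
then by reflecting, starting from simple roots, every root would lie in the span of one of the two parts,
and the roots would split into two orthogonal sets.\<close>

lemma simple_connected:
  assumes "A \<subseteq> \<Delta>" "A \<noteq> {}" "A \<noteq> \<Delta>"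
  shows "\<exists>\<delta>\<in>A. \<exists>\<delta>'\<in>\<Delta> - A. \<delta> \<bullet> \<delta>' < 0"
proof (rule ccontr)
  assume no: "\<not> ?thesis"
  have orth: "\<delta> \<bullet> \<delta>' = 0" if "\<delta> \<in> A" "\<delta>' \<in> \<Delta> - A" for \<delta> \<delta>'
    using that simple_obtuse[of \<delta> \<delta>'] assms(1) no by force
  have orth_span: "x \<bullet> y = 0" if "x \<in> span A" "y \<in> span (\<Delta> - A)" for x y
  proof -
    have 1: "orthogonal y' x" if "y' \<in> \<Delta> - A" for y'
      using orthogonal_to_span[OF \<open>x \<in> span A\<close>, of y'] orth that
      by (auto simp: orthogonal_def inner_commute)
    show ?thesis using orthogonal_to_span[OF \<open>y \<in> span (\<Delta> - A)\<close>, of x] 1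
      by (auto simp: orthogonal_def inner_commute)
  qed
  have "\<beta> \<in> span A \<or> \<beta> \<in> span (\<Delta> - A)" if "\<beta> \<in> P" for \<beta>
    using that
  proof (induction rule: pos_root_induct)
    case (simple \<delta>)
    then show ?case using span_base[of \<delta> A] span_base[of \<delta> "\<Delta> - A"] by blast
  next
    case (reflect \<delta> \<beta>)
    have r: "\<sigma> \<delta> \<beta> = \<beta> - (\<beta> \<bullet> coroot \<delta>) *\<^sub>R \<delta>" by (simp add: root_reflection_def)
    have z: "\<sigma> \<delta> \<beta> = \<beta>" if "\<beta> \<bullet> \<delta> = 0"
      using that by (simp add: r inner_coroot)
    consider "\<delta> \<in> A" "\<beta> \<in> span A" | "\<delta> \<in> \<Delta> - A" "\<beta> \<in> span (\<Delta> - A)"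
      | "\<delta> \<in> A" "\<beta> \<in> span (\<Delta> - A)" | "\<delta> \<in> \<Delta> - A" "\<beta> \<in> span A"
      using reflect by blast
    then show ?case
    proof cases
      case 1 then show ?thesis unfolding r by (auto intro!: span_diff span_scale intro: span_base)
    next
      case 2 then show ?thesis unfolding r by (auto intro!: span_diff span_scale intro: span_base)
    next
      case 3 then show ?thesis using z orth_span[of \<delta> \<beta>] span_base[of \<delta> A] by (simp add: inner_commute)
    next
      case 4 then show ?thesis using z orth_span[of \<beta> \<delta>] span_base[of \<delta> "\<Delta> - A"] by simp
    qed
  qed
  then have cover: "\<beta> \<in> span A \<or> \<beta> \<in> span (\<Delta> - A)" if "\<beta> \<in> \<Phi>" for \<beta>
    using pos_or_neg[OF that] span_neg[of "- \<beta>" A] span_neg[of "- \<beta>" "\<Delta> - A"] by auto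
  let ?U = "\<Phi> \<inter> span A" and ?V = "\<Phi> \<inter> span (\<Delta> - A)"
  obtain \<delta> \<delta>' where "\<delta> \<in> A" "\<delta>' \<in> \<Delta> - A" using assms by blast
  then have "\<delta> \<in> ?U" "\<delta>' \<in> ?V" using assms(1) simple_subset by (auto intro: span_base)
  then have "?U \<noteq> {}" "?V \<noteq> {}" by blast+
  moreover have "?U \<inter> ?V = {}"
  proof (rule ccontr)
    assume "?U \<inter> ?V \<noteq> {}"
    then obtain x where "x \<in> \<Phi>" "x \<in> span A" "x \<in> span (\<Delta> - A)" by blast
    then show False using orth_span[of x x] root_sq_pos[of x] by simp
  qed
  moreover have "?U \<union> ?V = \<Phi>" using cover by blast
  moreover have "\<forall>\<alpha>\<in>?U. \<forall>\<beta>\<in>?V. \<alpha> \<bullet> \<beta> = 0" using orth_span by blast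
  ultimately have "\<exists>U V. U \<noteq> {} \<and> V \<noteq> {} \<and> U \<inter> V = {} \<and> U \<union> V = \<Phi> \<and> (\<forall>\<alpha>\<in>U. \<forall>\<beta>\<in>V. \<alpha> \<bullet> \<beta> = 0)"
    by (intro exI[of _ ?U] exI[of _ ?V] conjI)
  then show False using irreducible unfolding irreducible_root_system_def by (elim conjE) (erule notE)
qed

lemma dominant_root_pos:
  assumes "\<alpha> \<in> \<Phi>" "\<And>\<delta>. \<delta> \<in> \<Delta> \<Longrightarrow> \<alpha> \<bullet> \<delta> \<ge> 0"
  shows "\<alpha> \<in> P"
proof (rule ccontr)
  assume "\<alpha> \<notin> P"
  then have "- \<alpha> \<in> P" using pos_or_neg assms by blast
  then have "\<alpha> \<bullet> (- \<alpha>) \<ge> 0" using inner_pos_root_nonneg assms(2) by blast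
  then show False using root_sq_pos[OF assms(1)] by simp
qed

text \<open>If some simple roots were missing from the support, connectedness would give one of them that is not
orthogonal to the support. All its pairings with the support are nonpositive, so it would pair negatively
with \<open>\<alpha>\<close>.\<close>

lemma dominant_root_full_support:
  assumes "\<alpha> \<in> \<Phi>" "\<And>\<delta>. \<delta> \<in> \<Delta> \<Longrightarrow> \<alpha> \<bullet> \<delta> \<ge> 0" "\<delta> \<in> \<Delta>"
  shows "coord \<delta> \<alpha> > 0"
proof -
  have p: "\<alpha> \<in> P" using dominant_root_pos assms by blast
  let ?A = "{\<delta>\<in>\<Delta>. coord \<delta> \<alpha> > 0}"
  have nn: "\<And>\<delta>. \<delta> \<in> \<Delta> \<Longrightarrow> coord \<delta> \<alpha> \<ge> 0" using p by (simp add: pos_root_iff)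
  have "?A \<noteq> {}"
  proof
    assume "?A = {}"
    then have "\<And>\<delta>. \<delta> \<in> \<Delta> \<Longrightarrow> coord \<delta> \<alpha> = 0" using nn by force
    then show False using coord_zero_imp root_nonzero[OF assms(1)] by blast
  qed
  have "?A = \<Delta>"
  proof (rule ccontr)
    assume "?A \<noteq> \<Delta>"
    then obtain \<delta> \<delta>' where d: "\<delta> \<in> ?A" "\<delta>' \<in> \<Delta> - ?A" "\<delta> \<bullet> \<delta>' < 0"
      using simple_connected[of ?A] \<open>?A \<noteq> {}\<close> by blast
    have le: "coord \<gamma> \<alpha> * (\<gamma> \<bullet> \<delta>') \<le> 0" if "\<gamma> \<in> \<Delta>" for \<gamma>
    proof (cases "\<gamma> = \<delta>'")
      case True
      have "coord \<delta>' \<alpha> = 0" using d nn[of \<delta>'] by auto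
      then show ?thesis using True by simp
    next
      case False
      then show ?thesis using simple_obtuse[of \<gamma> \<delta>'] d nn that by (simp add: mult_nonneg_nonpos)
    qed
    have "(\<Sum>\<gamma>\<in>\<Delta>. - (coord \<gamma> \<alpha> * (\<gamma> \<bullet> \<delta>'))) > 0"
      using d le finite_simple by (intro sum_pos2[of _ \<delta>]) (auto simp: mult_pos_neg)
    then have "\<alpha> \<bullet> \<delta>' < 0" using inner_coord[of \<alpha> \<delta>'] by (simp add: sum_negf)
    then show False using assms(2)[of \<delta>'] d by auto
  qed
  then show ?thesis using assms(3) by blast
qed

lemma dominant_roots_acute:
  assumes "\<alpha> \<in> \<Phi>" "\<And>\<delta>. \<delta> \<in> \<Delta> \<Longrightarrow> \<alpha> \<bullet> \<delta> \<ge> 0"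
    and "\<beta> \<in> \<Phi>" "\<And>\<delta>. \<delta> \<in> \<Delta> \<Longrightarrow> \<beta> \<bullet> \<delta> \<ge> 0"
  shows "\<alpha> \<bullet> \<beta> > 0"
proof -
  obtain \<delta> where d: "\<delta> \<in> \<Delta>" "\<beta> \<bullet> \<delta> > 0"
    using pos_root_simple_acute[OF dominant_root_pos[OF assms(3,4)]] by blast
  have "\<alpha> \<bullet> \<beta> = (\<Sum>\<delta>\<in>\<Delta>. coord \<delta> \<alpha> * (\<delta> \<bullet> \<beta>))" by (rule inner_coord)
  also have "\<dots> > 0"
    using d dominant_root_full_support[OF assms(1,2)] assms(4) finite_simple
    by (intro sum_pos2[of _ \<delta>]) (auto simp: inner_commute less_imp_le)
  finally show ?thesis .
qed

lemma short_root: "\<alpha>0 \<in> \<Phi>" and short_le: "\<beta> \<in> \<Phi> \<Longrightarrow> \<alpha>0 \<bullet> \<alpha>0 \<le> \<beta> \<bullet> \<beta>"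
  and short_sq: "\<alpha>0 \<bullet> \<alpha>0 = 2"
proof -
  have s: "\<alpha>0 \<in> short_roots \<Phi>" using maximal_short unfolding maximal_short_root_def by (rule conjunct1)
  then show "\<alpha>0 \<in> \<Phi>" "\<beta> \<in> \<Phi> \<Longrightarrow> \<alpha>0 \<bullet> \<alpha>0 \<le> \<beta> \<bullet> \<beta>" unfolding short_roots_def by simp_all
  show "\<alpha>0 \<bullet> \<alpha>0 = 2" using normalized s unfolding normalized_def by (rule bspec)
qed

lemma coroot_short: "coroot \<alpha>0 = \<alpha>0"
  by (simp add: coroot_def short_sq)

text \<open>Otherwise the reflection in \<open>\<delta>\<close> would produce a larger short root.\<close>

lemma short_dominant:
  assumes d: "\<delta> \<in> \<Delta>" shows "\<alpha>0 \<bullet> \<delta> \<ge> 0"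
proof (rule ccontr)
  assume "\<not> \<alpha>0 \<bullet> \<delta> \<ge> 0"
  then have neg: "\<alpha>0 \<bullet> coroot \<delta> < 0"
    using inner_coroot_sign(2)[OF root_nonzero[OF simple_root[OF d]], of \<alpha>0] by simp
  obtain m where m: "\<alpha>0 \<bullet> coroot \<delta> = of_int m"
    using cartan_int[OF simple_root[OF d] short_root] by (auto elim: Ints_cases)
  have e: "\<sigma> \<delta> \<alpha>0 - \<alpha>0 = (- of_int m) *\<^sub>R \<delta>" by (simp add: root_reflection_def m)
  have "- real_of_int m = real (nat (- m))" using neg m by simp
  then have "- real_of_int m \<in> \<nat>" using of_nat_in_Nats by metis
  then have "\<sigma> \<delta> \<alpha>0 - \<alpha>0 \<in> nat_cone \<Delta>"
    unfolding nat_cone_coord e using d by (simp add: coord_minus coord_scale coord_simple)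
  moreover have "\<sigma> \<delta> \<alpha>0 \<in> short_roots \<Phi>"
    using short_le refl_root[OF simple_root[OF d] short_root] by (simp add: short_roots_def)
  ultimately have "\<sigma> \<delta> \<alpha>0 = \<alpha>0" using maximal_short unfolding maximal_short_root_def by blast
  then show False using e neg m root_nonzero[OF simple_root[OF d]] by simp
qed

lemma short_pos: "\<alpha>0 \<in> P"
  using dominant_root_pos short_root short_dominant by blast

lemma short_pos_inner: "\<beta> \<in> P \<Longrightarrow> \<alpha>0 \<bullet> \<beta> \<ge> 0"
  using inner_pos_root_nonneg short_dominant by blast

text \<open>The vector \<open>\<beta> - \<alpha>0\<close> is nonzero and \<open>\<alpha>0\<close> is at most as long as \<open>\<beta>\<close>; this bounds the pairing strictly by 2.\<close>

lemma short_pairing_le_1: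
  assumes "\<beta> \<in> \<Phi>" "\<beta> \<noteq> \<alpha>0"
  shows "\<alpha>0 \<bullet> coroot \<beta> \<le> 1"
proof -
  have "(\<beta> - \<alpha>0) \<bullet> (\<beta> - \<alpha>0) > 0" using assms(2) by simp
  then have "2 * (\<alpha>0 \<bullet> \<beta>) < \<beta> \<bullet> \<beta> + \<alpha>0 \<bullet> \<alpha>0"
    by (simp add: inner_diff_left inner_diff_right inner_commute)
  also have "\<dots> \<le> 2 * (\<beta> \<bullet> \<beta>)" using short_le[OF assms(1)] by simp
  finally have "\<alpha>0 \<bullet> coroot \<beta> < 2"
    using root_sq_pos[OF assms(1)] by (simp add: inner_coroot pos_divide_less_eq)
  moreover obtain m where "\<alpha>0 \<bullet> coroot \<beta> = of_int m"
    using cartan_int[OF assms(1) short_root] by (rule Ints_cases)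
  ultimately show ?thesis by simp
qed

text \<open>Among the roots of a given length take one with the largest pairing with \<open>\<rho>\<close>: a simple reflection cannot
increase this pairing further.\<close>

lemma ex_dominant_conjugate:
  assumes "\<alpha> \<in> \<Phi>"
  obtains \<beta> where "\<beta> \<in> \<Phi>" "\<beta> \<bullet> \<beta> = \<alpha> \<bullet> \<alpha>" "\<And>\<delta>. \<delta> \<in> \<Delta> \<Longrightarrow> \<beta> \<bullet> \<delta> \<ge> 0"
proof -
  let ?B = "{\<beta>\<in>\<Phi>. \<beta> \<bullet> \<beta> = \<alpha> \<bullet> \<alpha>}"
  have "finite ?B" "?B \<noteq> {}" using finite_roots assms by auto
  then obtain \<beta> where b: "\<beta> \<in> ?B" and max: "\<And>\<gamma>. \<gamma> \<in> ?B \<Longrightarrow> \<rho> \<bullet> \<gamma> \<le> \<rho> \<bullet> \<beta>"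
    using ex_is_arg_min_if_finite[of ?B "\<lambda>\<beta>. - (\<rho> \<bullet> \<beta>)"] by (auto simp: is_arg_min_def not_less)
  have "\<beta> \<bullet> \<delta> \<ge> 0" if d: "\<delta> \<in> \<Delta>" for \<delta>
  proof -
    have "\<rho> \<bullet> \<sigma> \<delta> \<beta> \<le> \<rho> \<bullet> \<beta>" using max[of "\<sigma> \<delta> \<beta>"] b refl_root[OF simple_root[OF d]] by auto
    then have "(\<beta> \<bullet> coroot \<delta>) * (\<rho> \<bullet> \<delta>) \<ge> 0" by (simp add: inner_refl_simple)
    then have "\<beta> \<bullet> coroot \<delta> \<ge> 0" using rho_simple_pos[OF d] by (simp add: zero_le_mult_iff)
    then show ?thesis using inner_coroot_sign(2)[OF root_nonzero[OF simple_root[OF d]]] by simp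
  qed
  then show ?thesis using b by (intro that[of \<beta>]) simp_all
qed

lemma cartan_product_lt_4:
  assumes "\<alpha> \<in> \<Phi>" "\<beta> \<in> \<Phi>" "\<alpha> \<noteq> \<beta>" "\<alpha> \<noteq> - \<beta>"
  shows "(\<alpha> \<bullet> coroot \<beta>) * (\<beta> \<bullet> coroot \<alpha>) < 4"
proof -
  have "\<bar>\<alpha> \<bullet> \<beta>\<bar> \<noteq> norm \<alpha> * norm \<beta>"
  proof
    assume "\<bar>\<alpha> \<bullet> \<beta>\<bar> = norm \<alpha> * norm \<beta>"
    then have "norm \<alpha> *\<^sub>R \<beta> = norm \<beta> *\<^sub>R \<alpha> \<or> norm \<alpha> *\<^sub>R \<beta> = - norm \<beta> *\<^sub>R \<alpha>"
      by (simp add: norm_cauchy_schwarz_abs_eq)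
    then obtain c where "norm \<alpha> *\<^sub>R \<beta> = c *\<^sub>R \<alpha>" by blast
    then have "(1 / norm \<alpha>) *\<^sub>R norm \<alpha> *\<^sub>R \<beta> = (1 / norm \<alpha>) *\<^sub>R c *\<^sub>R \<alpha>" by simp
    then have "\<beta> = (c / norm \<alpha>) *\<^sub>R \<alpha>" using root_nonzero[OF assms(1)] by simp
    moreover from this have "c / norm \<alpha> = 1 \<or> c / norm \<alpha> = - 1"
      using reduced[OF assms(1), of "c / norm \<alpha>"] assms(2) by simp
    ultimately have "\<beta> = \<alpha> \<or> \<beta> = - \<alpha>" by (elim disjE) simp_all
    then show False using assms by auto
  qed
  then have "\<bar>\<alpha> \<bullet> \<beta>\<bar> < norm \<alpha> * norm \<beta>" using Cauchy_Schwarz_ineq2[of \<alpha> \<beta>] by simp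
  then have "\<bar>\<alpha> \<bullet> \<beta>\<bar>\<^sup>2 < (norm \<alpha> * norm \<beta>)\<^sup>2" by (intro power_strict_mono) auto
  then have lt: "(\<alpha> \<bullet> \<beta>)\<^sup>2 < (\<alpha> \<bullet> \<alpha>) * (\<beta> \<bullet> \<beta>)"
    by (simp add: power_mult_distrib power2_norm_eq_inner)
  have "(\<alpha> \<bullet> coroot \<beta>) * (\<beta> \<bullet> coroot \<alpha>) = 4 * ((\<alpha> \<bullet> \<beta>)\<^sup>2 / ((\<alpha> \<bullet> \<alpha>) * (\<beta> \<bullet> \<beta>)))"
    by (simp add: inner_coroot inner_commute power2_eq_square)
  also have "\<dots> < 4 * 1"
  proof -
    have "(\<alpha> \<bullet> \<alpha>) * (\<beta> \<bullet> \<beta>) > 0" using root_sq_pos assms(1,2) by (intro mult_pos_pos)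
    then have "(\<alpha> \<bullet> \<beta>)\<^sup>2 / ((\<alpha> \<bullet> \<alpha>) * (\<beta> \<bullet> \<beta>)) < 1" using lt by (subst pos_divide_less_eq) auto
    then show ?thesis by simp
  qed
  finally show ?thesis by simp
qed

text \<open>By \<open>ex_dominant_conjugate\<close> the root may be taken dominant. It then makes an acute angle with
\<open>\<alpha>0\<close>, so \<open>\<langle>\<alpha>0, \<beta>\<^sup>\<or>\<rangle> = 1\<close> unless the two are equal, and the length of \<open>\<beta>\<close> relative to \<open>\<alpha>0\<close> is the
opposite Cartan integer, which is at most 3.\<close>

lemma half_norm_cases:
  assumes "\<alpha> \<in> \<Phi>" shows "half_norm \<alpha> \<in> {1, 2, 3}"
proof -
  obtain \<beta> where b: "\<beta> \<in> \<Phi>" "\<beta> \<bullet> \<beta> = \<alpha> \<bullet> \<alpha>" "\<And>\<delta>. \<delta> \<in> \<Delta> \<Longrightarrow> \<beta> \<bullet> \<delta> \<ge> 0"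
    using ex_dominant_conjugate[OF assms] by metis
  have ac: "\<beta> \<bullet> \<alpha>0 > 0" using dominant_roots_acute[OF b(1) _ short_root] b(3) short_dominant by blast
  have h: "half_norm \<alpha> = half_norm \<beta>" by (simp add: half_norm_def b)
  show ?thesis
  proof (cases "\<beta> = \<alpha>0")
    case True
    then have "\<alpha> \<bullet> \<alpha> = 2" using b(2) short_sq by metis
    then show ?thesis by (simp add: half_norm_def)
  next
    case False
    have "\<beta> \<noteq> - \<alpha>0" using ac short_sq by auto
    obtain m where m: "\<beta> \<bullet> coroot \<alpha>0 = of_int m"
      using cartan_int[OF short_root b(1)] by (auto elim: Ints_cases)
    obtain n where n: "\<alpha>0 \<bullet> coroot \<beta> = of_int n"
      using cartan_int[OF b(1) short_root] by (auto elim: Ints_cases)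
    have "\<alpha>0 \<bullet> coroot \<beta> > 0"
      using inner_coroot_sign(1)[OF root_nonzero[OF b(1)]] ac by (simp add: inner_commute)
    then have n1: "n = 1" using n short_pairing_le_1[OF b(1) False] by simp
    have "real_of_int (m * n) < real_of_int 4"
      using cartan_product_lt_4[OF b(1) short_root False \<open>\<beta> \<noteq> - \<alpha>0\<close>] m n by simp
    then have "m < 4" unfolding of_int_less_iff using n1 by simp
    moreover have mm: "\<beta> \<bullet> \<alpha>0 = of_int m" using m by (simp add: coroot_short)
    then have "m > 0" using ac by simp
    moreover have "half_norm \<beta> = of_int m"
      using n n1 mm root_sq_pos[OF b(1)] by (simp add: half_norm_def inner_coroot inner_commute field_simps)
    ultimately have "m = 1 \<or> m = 2 \<or> m = 3" "half_norm \<beta> = of_int m" by auto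
    then show ?thesis using h by auto
  qed
qed

lemma half_norm_simple:
  assumes "\<alpha> \<in> \<Phi>" shows "\<exists>\<delta>\<in>\<Delta>. half_norm \<delta> = half_norm \<alpha>"
proof -
  \<comment> \<open>lengths are invariant under simple reflections\<close>
  have *: "\<exists>\<delta>\<in>\<Delta>. half_norm \<delta> = half_norm \<beta>" if "\<beta> \<in> P" for \<beta>
    using that by (induction rule: pos_root_induct) (auto simp: half_norm_def)
  have "half_norm (- \<alpha>) = half_norm \<alpha>" by (simp add: half_norm_def)
  then show ?thesis using pos_or_neg[OF assms] *[of \<alpha>] *[of "- \<alpha>"] by (elim disjE) simp_all
qed


text \<open>A positive definiteness argument. If \<open>c\<close> were joined to \<open>a\<close>, then \<open>4 \<langle>a, c\<rangle>\<^sup>2 \<ge> \<langle>a, a\<rangle> \<langle>c, c\<rangle>\<close>, since both Cartan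
integers are at most \<open>-1\<close>. So the projection of \<open>a + t b\<close> to the line of \<open>c\<close> would have at least the
length of \<open>a + t b\<close>, and \<open>a + t b\<close> would be a multiple of \<open>c\<close>. A short combination \<open>a + t b\<close> exists when
\<open>a\<close> and \<open>b\<close> are joined by a triple edge.\<close>

lemma no_third_simple_root:
  assumes abc: "a \<in> \<Delta>" "b \<in> \<Delta>" "c \<in> \<Delta>" "c \<noteq> a" "c \<noteq> b"
    and t: "t > 0"
    and small: "(a + t *\<^sub>R b) \<bullet> (a + t *\<^sub>R b) \<le> (a \<bullet> a) / 4"
  shows "c \<bullet> a = 0"
proof (rule ccontr)
  assume "c \<bullet> a \<noteq> 0"
  then have neg: "c \<bullet> a < 0" using simple_obtuse[of c a] abc by force
  obtain m where m: "c \<bullet> coroot a = of_int m" 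
    using cartan_int[of a c] simple_root abc by (auto elim: Ints_cases)
  obtain n where n: "a \<bullet> coroot c = of_int n" 
    using cartan_int[of c a] simple_root abc by (auto elim: Ints_cases)
  have pa: "a \<bullet> a > 0" and pc: "c \<bullet> c > 0" using root_sq_pos simple_root abc by auto
  have "c \<bullet> coroot a < 0" "a \<bullet> coroot c < 0"
    using neg inner_coroot_sign(2)[OF root_nonzero[OF simple_root], of a c]
      inner_coroot_sign(2)[OF root_nonzero[OF simple_root], of c a] abc by (auto simp: inner_commute)
  then have "m < 0" "n < 0" using m n by auto
  then have "m * n \<ge> 1" by (metis int_one_le_iff_zero_less mult_neg_neg)
  then have "(c \<bullet> coroot a) * (a \<bullet> coroot c) \<ge> 1" unfolding m n by (metis of_int_1_le_iff of_int_mult)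
  moreover have "(c \<bullet> coroot a) * (a \<bullet> coroot c) = 4 * (c \<bullet> a)\<^sup>2 / ((a \<bullet> a) * (c \<bullet> c))"
    by (simp add: inner_coroot inner_commute[of a c] power2_eq_square)
  ultimately have "1 * ((a \<bullet> a) * (c \<bullet> c)) \<le> 4 * (c \<bullet> a)\<^sup>2"
    using pa pc by (subst pos_le_divide_eq[symmetric]) auto
  then have ge: "(a \<bullet> a) / 4 \<le> (c \<bullet> a)\<^sup>2 / (c \<bullet> c)"
    using pc by (subst pos_le_divide_eq) auto
  let ?y = "a + t *\<^sub>R b"
  have "c \<bullet> b \<le> 0" using simple_obtuse abc by simp
  then have "c \<bullet> ?y \<le> c \<bullet> a" using t by (simp add: inner_add_right mult_nonneg_nonpos)
  then have sq: "(c \<bullet> ?y)\<^sup>2 \<ge> (c \<bullet> a)\<^sup>2" using neg by (simp add: abs_le_square_iff[symmetric])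
  define r where "r = (c \<bullet> ?y) / (c \<bullet> c)"
  \<comment> \<open>the component of \<open>?y\<close> orthogonal to \<open>c\<close>\<close>
  define z where "z = ?y - r *\<^sub>R c"
  have "z \<bullet> z = ?y \<bullet> ?y - 2 * r * (c \<bullet> ?y) + r\<^sup>2 * (c \<bullet> c)"
    unfolding z_def inner_diff_left inner_diff_right inner_scaleR_left inner_scaleR_right inner_commute[of ?y c]
    by (simp add: power2_eq_square algebra_simps)
  also have "\<dots> = ?y \<bullet> ?y - (c \<bullet> ?y)\<^sup>2 / (c \<bullet> c)"
    using pc by (simp add: r_def power2_eq_square field_simps)
  also have "\<dots> \<le> (a \<bullet> a) / 4 - (c \<bullet> a)\<^sup>2 / (c \<bullet> c)"
    using small sq pc by (intro diff_mono divide_right_mono) auto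
  also have "\<dots> \<le> 0" using ge by simp
  finally have "z \<bullet> z = 0" using inner_ge_zero[of z] by linarith
  then have "coord a z = 0" by (simp add: real_vector.representation_zero)
  moreover have "a \<noteq> b"
  proof
    assume "a = b"
    then have "a + t *\<^sub>R b = (1 + t) *\<^sub>R a" by (simp add: algebra_simps)
    then have "(1 + t)\<^sup>2 * (a \<bullet> a) \<le> (a \<bullet> a) / 4" using small by (simp add: power2_eq_square mult.assoc)
    moreover have "(1 + t)\<^sup>2 > 1" using t by (intro one_less_power) auto
    then have "(1 + t)\<^sup>2 * (a \<bullet> a) > 1 * (a \<bullet> a)" using pa by (intro mult_strict_right_mono)
    ultimately show False using pa by linarith
  qed
  ultimately show False using abc by (simp add: z_def coord_diff coord_add coord_scale coord_simple)
qed

text \<open>Simple roots of both lengths exist, because simple reflections preserve lengths. Connectedness of the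
diagram gives adjacent simple roots \<open>a\<close>, \<open>b\<close> of which only \<open>a\<close> has the triple length, and their Cartan
integers must then be \<open>-3\<close> and \<open>-1\<close>. Such a triple edge leaves no room for a third simple root.\<close>

lemma triple_length_G2:
  assumes "\<alpha> \<in> \<Phi>" "half_norm \<alpha> = 3"
  shows "has_dynkin_type \<Delta> TypeG2"
proof -
  let ?A = "{\<delta>\<in>\<Delta>. half_norm \<delta> = 3}"
  have "?A \<noteq> {}" using half_norm_simple[OF assms(1)] assms(2) by auto
  moreover have "?A \<noteq> \<Delta>"
  proof -
    have "half_norm \<alpha>0 = 1" by (simp add: half_norm_def short_sq)
    then obtain \<delta> where "\<delta> \<in> \<Delta>" "half_norm \<delta> = 1" using half_norm_simple[OF short_root] by metis
    then show ?thesis by force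
  qed
  ultimately obtain a b where ab: "a \<in> ?A" "b \<in> \<Delta> - ?A" "a \<bullet> b < 0"
    using simple_connected[of ?A] by blast
  then have a: "a \<in> \<Delta>" "a \<bullet> a = 6" and b: "b \<in> \<Delta>" "b \<bullet> b = 2 \<or> b \<bullet> b = 4"
    using half_norm_cases[OF simple_root, of b] by (auto simp: half_norm_def)
  have "a \<noteq> b" "a \<noteq> - b" using a b by auto
  obtain m where m: "a \<bullet> coroot b = of_int m"
    using cartan_int[of b a] simple_root a b by (auto elim: Ints_cases)
  obtain n where n: "b \<bullet> coroot a = of_int n"
    using cartan_int[of a b] simple_root a b by (auto elim: Ints_cases)
  have "b \<bullet> coroot a < 0"
    using ab(3) inner_coroot_sign(2)[OF root_nonzero[OF simple_root], of a b] a by (auto simp: inner_commute)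
  then have "n < 0" using n by simp
  have "real_of_int (m * n) < real_of_int 4"
    using cartan_product_lt_4[of a b] simple_root a b \<open>a \<noteq> b\<close> \<open>a \<noteq> - b\<close> m n by simp
  then have mn: "m * n < 4" unfolding of_int_less_iff .
  have "b \<bullet> b * of_int m = 6 * of_int n"
    using m n a b root_sq_pos[OF simple_root[OF b(1)]] by (simp add: inner_coroot inner_commute field_simps)
  then have "b \<bullet> b = 2 \<and> real_of_int m = real_of_int (3 * n) \<or> real_of_int (2 * m) = real_of_int (3 * n)"
    using b(2) by auto
  then have mn2: "b \<bullet> b = 2 \<and> m = 3 * n \<or> 2 * m = 3 * n"
    unfolding of_int_eq_iff .
  have "b \<bullet> b = 2 \<and> m = - 3 \<and> n = - 1"
  proof -
    have nn: "n = - 1"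
    proof (rule ccontr)
      assume "n \<noteq> - 1"
      then have "n \<le> - 2" using \<open>n < 0\<close> by simp
      moreover have "m \<le> - 3" using mn2 \<open>n \<le> - 2\<close> by auto
      ultimately have "(- m) * (- n) \<ge> 3 * 2" by (intro mult_mono) auto
      then show False using mn by simp
    qed
    \<comment> \<open>this excludes relative length \<open>3/2\<close>\<close>
    moreover have "2 * m \<noteq> 3 * n" using nn by presburger
    ultimately show ?thesis using mn2 by simp
  qed
  then have bb: "b \<bullet> b = 2" and m3: "a \<bullet> coroot b = - 3" and n1: "b \<bullet> coroot a = - 1" using m n by auto
  have inner: "a \<bullet> b = - 3" using n1 a by (simp add: inner_coroot inner_commute)
  have "\<Delta> = {a, b}"
  proof (rule ccontr)
    assume "\<Delta> \<noteq> {a, b}"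
    then obtain x c where c: "x \<in> {a, b}" "c \<in> \<Delta> - {a, b}" "x \<bullet> c < 0"
      using simple_connected[of "{a, b}"] a b by blast
    have cn: "c \<in> \<Delta>" "c \<noteq> a" "c \<noteq> b" using c by auto
    have inner': "b \<bullet> a = - 3" using inner by (simp add: inner_commute)
    \<comment> \<open>\<open>2 a + 3 b\<close> and \<open>a + 2 b\<close> are highest roots of \<open>G\<^sub>2\<close>, orthogonal to \<open>b\<close> and \<open>a\<close>\<close>
    have "(a + (3/2) *\<^sub>R b) \<bullet> (a + (3/2) *\<^sub>R b) \<le> (a \<bullet> a) / 4"
      by (simp add: inner_add_left inner_add_right a bb inner inner')
    then have ca: "c \<bullet> a = 0"
      using no_third_simple_root[OF a(1) b(1) cn, of "3/2"] by simp
    have "(b + (1/2) *\<^sub>R a) \<bullet> (b + (1/2) *\<^sub>R a) \<le> (b \<bullet> b) / 4"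
      by (simp add: inner_add_left inner_add_right a bb inner inner')
    then have cb: "c \<bullet> b = 0"
      using no_third_simple_root[OF b(1) a(1) cn(1,3,2), of "1/2"] by simp
    have "x = a \<or> x = b" using c by simp
    then show False using c(3) ca cb inner_commute[of x c] by auto
  qed
  \<comment> \<open>Bourbaki's numbering of \<open>G\<^sub>2\<close> starts with the short root.\<close>
  define f where "f i = (if i = 1 then b else a)" for i :: nat
  have I: "{1..2::nat} = {1, 2}" by auto
  have "{Suc 0, 2} \<in> chain 1 2" unfolding chain_def by (auto intro!: exI[of _ "Suc 0"])
  then have ch: "{Suc 0, 2} \<in> chain (Suc 0) 2" "{2, Suc 0} \<in> chain (Suc 0) 2"
    by (simp_all add: insert_commute)
  have "a \<bullet> coroot a = 2" "b \<bullet> coroot b = 2"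
    using self_inner_coroot[OF root_nonzero[OF simple_root]] a(1) b(1) by blast+
  then have "\<forall>i\<in>{1..2}. \<forall>j\<in>{1..2}. f i \<bullet> coroot (f j) = of_int (cartan_entry TypeG2 i j)"
    unfolding I by (simp add: f_def graph_entry_def ch m3 n1)
  moreover have "bij_betw f {1..2} \<Delta>"
    unfolding I \<open>\<Delta> = {a, b}\<close> bij_betw_def inj_on_def
    using \<open>a \<noteq> b\<close> by (auto simp: f_def)
  ultimately show ?thesis unfolding has_dynkin_type_def type_rank.simps valid_type.simps
    by (intro conjI TrueI exI[of _ f])
qed

lemma inner_eq_half_norm: "\<alpha> \<noteq> 0 \<Longrightarrow> half_norm \<alpha> * (x \<bullet> coroot \<alpha>) = x \<bullet> \<alpha>"
  by (simp add: half_norm_def inner_coroot)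

lemma half_norm_int: "\<alpha> \<in> \<Phi> \<Longrightarrow> half_norm \<alpha> \<in> \<int>"
  using half_norm_cases[of \<alpha>] by auto

end

section \<open>The affine Weyl group and its Coxeter generators\<close>

lemma BijGroup_UNIV_mult: "f \<otimes>\<^bsub>BijGroup UNIV\<^esub> g = f \<circ> g"
  if "bij f" "bij g"
  using that by (simp add: BijGroup_def Bij_def fun_eq_iff compose_def)

lemma BijGroup_UNIV_inv: "bij f \<Longrightarrow> inv\<^bsub>BijGroup UNIV\<^esub> f = inv_into UNIV f"
  by (subst inv_BijGroup) (simp_all add: Bij_def restrict_def)

text \<open>This form of the induction lets arguments about the two Weyl groups work with plain composition and
functional inverses.\<close>

lemma generate_BijGroup_induct [consumes 1, case_names bij one generator inverse mult]:
  assumes "f \<in> generate (BijGroup UNIV) G"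
    and bij: "\<And>g. g \<in> G \<Longrightarrow> bij g"
    and one: "Q id"
    and gen: "\<And>g. g \<in> G \<Longrightarrow> Q g"
    and inv: "\<And>g. g \<in> G \<Longrightarrow> Q (inv_into UNIV g)"
    and mult: "\<And>f g. Q f \<Longrightarrow> Q g \<Longrightarrow> Q (f \<circ> g)"
  shows "Q f"
proof -
  have "Q f \<and> bij f"
    using assms(1)
  proof (induction rule: generate.induct)
    case one
    have "\<one>\<^bsub>BijGroup UNIV\<^esub> = id" by (simp add: BijGroup_def restrict_def id_def)
    then show ?case using assms(3) bij_id by metis
  next
    case (incl h) then show ?case using bij gen by blast
  next
    case (inv h)
    then show ?case using bij[of h] assms(5)[of h] by (simp add: BijGroup_UNIV_inv bij_imp_bij_inv)
  next
    case (eng h1 h2)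
    then show ?case using mult BijGroup_UNIV_mult bij_comp by metis
  qed
  then show ?thesis by blast
qed

lemma bij_involution: "(\<And>y. f (f y) = y) \<Longrightarrow> bij f"
  by (rule o_bij[of f f]) (simp_all add: fun_eq_iff)

lemma inv_involution: "(\<And>y. f (f y) = y) \<Longrightarrow> inv_into UNIV f = f"
  by (rule inv_unique_comp) (simp_all add: fun_eq_iff)

text \<open>The affine root whose zero set is the hyperplane fixed by \<open>affine_reflection ell \<alpha> k\<close>.\<close>

definition wall_form :: "nat \<Rightarrow> 'a::euclidean_space \<Rightarrow> int \<Rightarrow> 'a \<Rightarrow> real" where
  "wall_form ell \<alpha> k y = y \<bullet> coroot \<alpha> - of_int k * of_nat ell"

lemma affine_reflection_wall_form:
  "affine_reflection ell \<alpha> k y = y - wall_form ell \<alpha> k y *\<^sub>R \<alpha>"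
  by (simp add: affine_reflection_def wall_form_def)

lemma wall_form_minus: "wall_form ell (- \<alpha>) (- k) y = - wall_form ell \<alpha> k y"
  by (simp add: wall_form_def)

lemma affine_reflection_minus: "affine_reflection ell (- \<alpha>) (- k) = affine_reflection ell \<alpha> k"
  by (simp add: affine_reflection_wall_form wall_form_minus fun_eq_iff)

lemma affine_reflection_diff:
  "affine_reflection ell \<gamma> j (y - c *\<^sub>R v) = affine_reflection ell \<gamma> j y - c *\<^sub>R root_reflection \<gamma> v"
  by (simp add: affine_reflection_def root_reflection_def inner_diff_left algebra_simps)

lemma affine_reflection_linear_part:
  "affine_reflection ell \<gamma> j y = root_reflection \<gamma> y + (of_int j * of_nat ell) *\<^sub>R \<gamma>"
  by (simp add: affine_reflection_def root_reflection_def algebra_simps)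

lemma affine_reflection_involution:
  assumes "\<gamma> \<noteq> 0" shows "affine_reflection ell \<gamma> j (affine_reflection ell \<gamma> j y) = y"
proof -
  have "wall_form ell \<gamma> j (affine_reflection ell \<gamma> j y) = - wall_form ell \<gamma> j y"
    using assms by (simp add: affine_reflection_wall_form)
      (simp add: wall_form_def inner_diff_left)
  then show ?thesis
    by (subst affine_reflection_wall_form) (simp add: affine_reflection_wall_form)
qed

text \<open>Affine reflections permute the affine roots.\<close>

lemma wall_form_affine_reflection:
  assumes "\<gamma> \<bullet> coroot \<alpha> = of_int m"
  shows "wall_form ell \<alpha> k (affine_reflection ell \<gamma> j y) =
    wall_form ell (root_reflection \<gamma> \<alpha>) (k - j * m) y"
  using assms
  by (simp add: wall_form_def affine_reflection_linear_part inner_coroot_root_reflection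
      inner_add_left algebra_simps)

lemma affine_reflection_conjugate:
  assumes "\<gamma> \<bullet> coroot \<alpha> = of_int m"
  shows "affine_reflection ell \<alpha> k (affine_reflection ell \<gamma> j y) =
    affine_reflection ell \<gamma> j (affine_reflection ell (root_reflection \<gamma> \<alpha>) (k - j * m) y)"
  unfolding affine_reflection_wall_form[of ell "root_reflection \<gamma> \<alpha>"] affine_reflection_diff
    affine_reflection_wall_form[of ell \<alpha>] wall_form_affine_reflection[OF assms]
  by simp

text \<open>The product of a word in the form in which \<open>coxeter_length\<close> refers to it.\<close>

definition prod_word :: "('b \<Rightarrow> 'b) list \<Rightarrow> 'b \<Rightarrow> 'b" where
  "prod_word ws = foldr (\<circ>) ws id"

lemma prod_word_simps [simp]:
  "prod_word [] y = y" "prod_word (g # ws) y = g (prod_word ws y)"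
  by (simp_all add: prod_word_def)

lemma prod_word_append [simp]: "prod_word (us @ vs) y = prod_word us (prod_word vs y)"
  by (induction us) simp_all

locale affine_root_system = irreducible_based_root_system +
  fixes ell :: nat
  assumes ell_gt: "real ell > coxeter_number \<Phi> \<Delta> \<alpha>0"
begin

abbreviation "form \<equiv> wall_form ell"
abbreviation "s_aff \<equiv> affine_reflection ell"
abbreviation "generators \<equiv> coxeter_generators \<Delta> \<alpha>0 ell"

text \<open>The walls of the antidominant alcove, oriented so that the affine roots are positive on the alcove: this
is the reason for the sign of the simple roots.\<close>

definition simple_walls :: "('a \<times> int) set" where
  "simple_walls = (\<lambda>\<delta>. (- \<delta>, 0)) ` \<Delta> \<union> {(\<alpha>0, - 1)}"

lemma generators_simple_walls:
  "generators = (\<lambda>(\<gamma>, j). s_aff \<gamma> j) ` simple_walls"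
proof -
  have "s_aff (- \<delta>) 0 = s_aff \<delta> 0" for \<delta> :: 'a using affine_reflection_minus[of ell \<delta> 0] by simp
  then have "(\<lambda>\<delta>. s_aff \<delta> 0) ` \<Delta> = (\<lambda>\<delta>. s_aff (- \<delta>) 0) ` \<Delta>" by (intro image_cong) auto
  then show ?thesis unfolding coxeter_generators_def simple_walls_def by (simp add: image_image)
qed

lemma simple_wall_root: "(\<gamma>, j) \<in> simple_walls \<Longrightarrow> \<gamma> \<in> \<Phi>"
  using short_root simple_root by (auto simp: simple_walls_def)

lemma simple_wall_generator: "(\<gamma>, j) \<in> simple_walls \<Longrightarrow> s_aff \<gamma> j \<in> generators"
  unfolding generators_simple_walls by (rule image_eqI[of _ _ "(\<gamma>, j)"]) simp_all

lemma generator_cases: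
  assumes "g \<in> generators" obtains \<gamma> j where "(\<gamma>, j) \<in> simple_walls" "g = s_aff \<gamma> j"
  using assms unfolding generators_simple_walls by (elim imageE case_prodE) auto

lemma s_aff_s_aff: "\<gamma> \<in> \<Phi> \<Longrightarrow> s_aff \<gamma> j (s_aff \<gamma> j y) = y"
  using affine_reflection_involution root_nonzero by blast

lemma cartan_integer:
  assumes "\<alpha> \<in> \<Phi>" "\<beta> \<in> \<Phi>" obtains m where "\<beta> \<bullet> coroot \<alpha> = of_int m"
  using cartan_int[OF assms] by (rule Ints_cases)

lemma rho_coroot_pos: "\<beta> \<in> P \<Longrightarrow> \<rho> \<bullet> coroot \<beta> > 0"
  using rho_pos_root inner_coroot_sign(1)[OF root_nonzero[OF pos_root]] by blast

lemma refl_short_neg: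
  assumes "\<alpha>0 \<bullet> \<alpha> > 0" "\<alpha> \<in> \<Phi>" shows "- \<sigma> \<alpha>0 \<alpha> \<in> P"
proof -
  have "\<alpha>0 \<bullet> \<sigma> \<alpha>0 \<alpha> = - (\<alpha>0 \<bullet> \<alpha>)"
    using root_reflection_self[OF root_nonzero[OF short_root]]
    by (simp flip: inner_root_reflection_left)
  then have "\<sigma> \<alpha>0 \<alpha> \<notin> P" using short_pos_inner[of "\<sigma> \<alpha>0 \<alpha>"] assms(1) by auto
  then show ?thesis using pos_or_neg[OF refl_root[OF short_root assms(2)]] by blast
qed

text \<open>The coroot of \<open>\<alpha>0\<close> is the highest one. Take a positive root \<open>\<alpha>\<close> whose coroot has the largest pairing
with \<open>\<rho>\<close>. It is dominant, hence at an acute angle to \<open>\<alpha>0\<close>. If it differs from \<open>\<alpha>0\<close>, then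
\<open>\<langle>\<alpha>0, \<alpha>\<^sup>\<or>\<rangle> = 1\<close> and \<open>\<sigma> \<alpha>0 \<alpha>\<close> is negative with coroot \<open>\<alpha>\<^sup>\<or> - \<alpha>0\<^sup>\<or>\<close>, so \<open>\<alpha>0\<close> has an even larger pairing.\<close>

lemma rho_coroot_le_short:
  assumes "\<beta> \<in> P" shows "\<rho> \<bullet> coroot \<beta> \<le> \<rho> \<bullet> coroot \<alpha>0"
proof -
  have "P \<noteq> {}" using assms by blast
  then obtain \<alpha> where al: "\<alpha> \<in> P" and max: "\<And>\<gamma>. \<gamma> \<in> P \<Longrightarrow> \<rho> \<bullet> coroot \<gamma> \<le> \<rho> \<bullet> coroot \<alpha>"
    using ex_is_arg_min_if_finite[OF finite_pos, of "\<lambda>\<beta>. - (\<rho> \<bullet> coroot \<beta>)"]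
    by (auto simp: is_arg_min_def not_less)
  have dom: "\<alpha> \<bullet> \<delta> \<ge> 0" if d: "\<delta> \<in> \<Delta>" for \<delta>
  proof (rule ccontr)
    assume "\<not> \<alpha> \<bullet> \<delta> \<ge> 0"
    then have neg: "\<delta> \<bullet> coroot \<alpha> < 0" "\<alpha> \<noteq> \<delta>"
      using inner_coroot_sign(2)[OF root_nonzero[OF pos_root[OF al]], of \<delta>]
      by (auto simp: inner_commute)
    have "\<rho> \<bullet> coroot (\<sigma> \<delta> \<alpha>) = \<rho> \<bullet> coroot \<alpha> - \<delta> \<bullet> coroot \<alpha>"
      by (simp add: inner_coroot_root_reflection refl_simple_rho[OF d] inner_diff_left)
    then show False using max[OF refl_simple_pos[OF d al neg(2)]] neg(1) by simp
  qed
  have "\<rho> \<bullet> coroot \<alpha> \<le> \<rho> \<bullet> coroot \<alpha>0"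
  proof (cases "\<alpha> = \<alpha>0")
    case False
    have ac: "\<alpha>0 \<bullet> \<alpha> > 0"
      by (rule dominant_roots_acute[OF short_root short_dominant pos_root[OF al] dom])
    then have "\<alpha>0 \<bullet> coroot \<alpha> > 0"
      using inner_coroot_sign(1)[OF root_nonzero[OF pos_root[OF al]]] by blast
    moreover obtain m where "\<alpha>0 \<bullet> coroot \<alpha> = of_int m"
      using cartan_integer[OF pos_root[OF al] short_root] .
    ultimately have one: "\<alpha>0 \<bullet> coroot \<alpha> = 1"
      using short_pairing_le_1[OF pos_root[OF al] False] by simp
    have "\<rho> \<bullet> coroot (- \<sigma> \<alpha>0 \<alpha>) > 0"
      by (rule rho_coroot_pos[OF refl_short_neg[OF ac pos_root[OF al]]])
    moreover have "\<rho> \<bullet> coroot (\<sigma> \<alpha>0 \<alpha>) = \<rho> \<bullet> coroot \<alpha> - \<rho> \<bullet> coroot \<alpha>0"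
      unfolding inner_coroot_root_reflection
      by (simp add: root_reflection_def[of \<alpha>0 \<rho>] inner_diff_left one)
    ultimately show ?thesis by simp
  qed simp
  then show ?thesis using max[OF assms] by simp
qed

lemma rho_coroot_less: "\<beta> \<in> P \<Longrightarrow> \<rho> \<bullet> coroot \<beta> < ell"
  using rho_coroot_le_short[of \<beta>] ell_gt unfolding coxeter_number_def by simp

lemma ell_pos: "ell > 0"
  using rho_coroot_less[OF short_pos] rho_coroot_pos[OF short_pos] by simp

text \<open>The sign of an affine root on the antidominant alcove, where \<open>0 < \<langle>\<rho>, \<alpha>\<^sup>\<or>\<rangle> < ell\<close> for positive \<open>\<alpha>\<close>.\<close>

lemma form_pos_root:
  assumes "\<alpha> \<in> P"
  shows "form \<alpha> k (- \<rho>) > 0 \<longleftrightarrow> k < 0" "form \<alpha> k (- \<rho>) < 0 \<longleftrightarrow> k \<ge> 0"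
proof -
  have "form \<alpha> k (- \<rho>) > 0" if "k < 0"
  proof -
    have "- real_of_int k * real ell \<ge> 1 * real ell" using that by (intro mult_right_mono) auto
    then show ?thesis using rho_coroot_less[OF assms] by (simp add: wall_form_def)
  qed
  moreover have "form \<alpha> k (- \<rho>) < 0" if "k \<ge> 0"
  proof -
    have "real_of_int k * ell \<ge> 0" using that by simp
    then show ?thesis using rho_coroot_pos[OF assms] by (simp add: wall_form_def)
  qed
  ultimately show "form \<alpha> k (- \<rho>) > 0 \<longleftrightarrow> k < 0" "form \<alpha> k (- \<rho>) < 0 \<longleftrightarrow> k \<ge> 0"
    by (meson not_less not_less_iff_gr_or_eq)+
qed

lemma form_neg_root:
  assumes "- \<alpha> \<in> P"
  shows "form \<alpha> k (- \<rho>) > 0 \<longleftrightarrow> k \<le> 0" "form \<alpha> k (- \<rho>) < 0 \<longleftrightarrow> k > 0"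
  using form_pos_root[OF assms, of "- k"] by (simp_all add: wall_form_minus)

lemma form_nonzero: "\<alpha> \<in> \<Phi> \<Longrightarrow> form \<alpha> k (- \<rho>) \<noteq> 0"
  using pos_or_neg[of \<alpha>] form_pos_root[of \<alpha> k] form_neg_root[of \<alpha> k] by linarith

lemma simple_wall_pos: "(\<gamma>, j) \<in> simple_walls \<Longrightarrow> form \<gamma> j (- \<rho>) > 0"
  using form_pos_root(1)[OF short_pos, of "-1"] form_neg_root(1)[of "- \<delta>" 0 for \<delta>] simple_pos
  by (auto simp: simple_walls_def)

text \<open>Crossing a wall of the alcove changes the sign of no affine root but the one defining that wall. It is the
affine version of the fact that a simple reflection permutes the other positive roots. For the
additional wall \<open>(\<alpha>0, -1)\<close> the argument uses that \<open>\<langle>\<alpha>0, \<beta>\<^sup>\<or>\<rangle>\<close> is 0 or 1 for every positive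
\<open>\<beta> \<noteq> \<alpha>0\<close>, and that in the second case \<open>\<sigma> \<alpha>0 \<beta>\<close> is negative.\<close>

lemma flip_only_own_wall:
  assumes w: "(\<gamma>, j) \<in> simple_walls" and a: "\<alpha> \<in> \<Phi>"
    and neg: "form \<alpha> k (- \<rho>) < 0" and pos: "form \<alpha> k (s_aff \<gamma> j (- \<rho>)) > 0"
  shows "\<alpha> = - \<gamma> \<and> k = - j"
proof -
  obtain m where m: "\<gamma> \<bullet> coroot \<alpha> = of_int m"
    using cartan_integer[OF a simple_wall_root[OF w]] .
  have pos': "form (\<sigma> \<gamma> \<alpha>) (k - j * m) (- \<rho>) > 0"
    using pos wall_form_affine_reflection[OF m] by simp
  consider (simple) \<delta> where "\<delta> \<in> \<Delta>" "\<gamma> = - \<delta>" "j = 0" | (short) "\<gamma> = \<alpha>0" "j = - 1"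
    using w by (auto simp: simple_walls_def)
  then show ?thesis
  proof cases
    case simple
    have pos'': "form (\<sigma> \<delta> \<alpha>) k (- \<rho>) > 0" using pos' simple by simp
    show ?thesis
    proof (cases "\<alpha> \<in> P")
      case True
      then have k: "k \<ge> 0" using form_pos_root(2) neg by blast
      have "\<sigma> \<delta> \<alpha> \<notin> P" using form_pos_root(1) pos'' k by force
      then have "\<alpha> = \<delta>" using refl_simple_pos[OF simple(1) True] by blast
      moreover from this have "- \<sigma> \<delta> \<alpha> \<in> P"
        using simple_pos[OF simple(1)] root_reflection_self[OF root_nonzero[OF simple_root[OF simple(1)]]]
        by simp
      then have "k \<le> 0" using form_neg_root(1) pos'' by blast
      ultimately show ?thesis using k simple by simp
    next
      case False
      then have n: "- \<alpha> \<in> P" using pos_or_neg[OF a] by blast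
      then have k: "k > 0" using form_neg_root(2) neg by blast
      have "\<sigma> \<delta> \<alpha> \<in> P \<or> - \<sigma> \<delta> \<alpha> \<in> P"
        using pos_or_neg refl_root[OF simple_root[OF simple(1)] a] by blast
      then show ?thesis using form_pos_root(1)[of "\<sigma> \<delta> \<alpha>" k] form_neg_root(1)[of "\<sigma> \<delta> \<alpha>" k] pos'' k
        by auto
    qed
  next
    case short
    have pos'': "form (\<sigma> \<alpha>0 \<alpha>) (k + m) (- \<rho>) > 0" using pos' short by simp
    have m0: "\<alpha>0 \<bullet> coroot \<alpha> = of_int m" using m short by simp
    have fix0: "\<sigma> \<alpha>0 \<alpha> = \<alpha>" if "m = 0"
      using that m0 inner_coroot_sign(3)[OF root_nonzero[OF a], of \<alpha>0]
      by (simp add: root_reflection_def coroot_short inner_commute)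
    have acute: "m > 0 \<longleftrightarrow> \<alpha>0 \<bullet> \<alpha> > 0"
      using m0 inner_coroot_sign(1)[OF root_nonzero[OF a], of \<alpha>0] by simp
    show ?thesis
    proof (cases "\<alpha> \<in> P")
      case True
      then have k: "k \<ge> 0" using form_pos_root(2) neg by blast
      have "m \<ge> 0" using short_pos_inner[OF True] m0 inner_coroot_sign(2)[OF root_nonzero[OF a], of \<alpha>0] by simp
      show ?thesis
      proof (cases "m = 0")
        case True
        then show ?thesis using fix0 pos'' neg by simp
      next
        case False
        then have "- \<sigma> \<alpha>0 \<alpha> \<in> P" using refl_short_neg acute \<open>m \<ge> 0\<close> a by simp
        then show ?thesis using form_neg_root(1) pos'' k False \<open>m \<ge> 0\<close> by force
      qed
    next
      case False
      then have n: "- \<alpha> \<in> P" using pos_or_neg[OF a] by blast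
      then have k: "k > 0" using form_neg_root(2) neg by blast
      have m1: "\<alpha>0 \<bullet> coroot (- \<alpha>) = of_int (- m)" using m0 by simp
      have "- m \<ge> 0"
        using short_pos_inner[OF n] m1 inner_coroot_sign(2)[OF root_nonzero[OF pos_root[OF n]], of \<alpha>0]
        by simp
      show ?thesis
      proof (cases "m = 0")
        case True
        then show ?thesis using fix0 pos'' neg by simp
      next
        case mnz: False
        have p: "\<sigma> \<alpha>0 \<alpha> \<in> P"
          using refl_short_neg[of "- \<alpha>"] acute pos_root[OF n] mnz \<open>- m \<ge> 0\<close> m1
            inner_coroot_sign(1)[OF root_nonzero[OF pos_root[OF n]], of \<alpha>0] by simp
        then have lt: "k + m < 0" using form_pos_root(1) pos'' by blast
        show ?thesis
        proof (cases "- \<alpha> = \<alpha>0")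
          case True
          then have al: "\<alpha> = - \<alpha>0" by (metis minus_minus)
          have "m = - 2" using m0 unfolding al by (simp add: coroot_short short_sq)
          then have "k = 1" using k lt by simp
          then show ?thesis using al short by simp
        next
          case False
          then have "- m \<le> 1" using short_pairing_le_1[OF pos_root[OF n] False] m1 by simp
          then show ?thesis using lt k by simp
        qed
      qed
    qed
  qed
qed

text \<open>Read the word as a gallery from the alcove to its image. If the hyperplane of \<open>(\<alpha>, k)\<close> separates the
two ends, it is crossed at some letter; by \<open>flip_only_own_wall\<close> it is there the wall belonging to
that letter, and reflecting the rest of the gallery in it removes the letter.\<close>

lemma deletion:
  assumes "set ws \<subseteq> generators" "\<alpha> \<in> \<Phi>"
    and "form \<alpha> k (- \<rho>) < 0" "form \<alpha> k (prod_word ws (- \<rho>)) \<ge> 0"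
  shows "\<exists>vs. set vs \<subseteq> generators \<and> length vs < length ws \<and> s_aff \<alpha> k \<circ> prod_word ws = prod_word vs"
  using assms
proof (induction ws arbitrary: \<alpha> k)
  case Nil
  then show ?case by simp
next
  case (Cons g ws)
  have gg: "g \<in> generators" "set ws \<subseteq> generators" using Cons.prems(1) by simp_all
  obtain \<gamma> j where w: "(\<gamma>, j) \<in> simple_walls" and g: "g = s_aff \<gamma> j"
    using generator_cases[OF gg(1)] .
  have ga: "\<gamma> \<in> \<Phi>" by (rule simple_wall_root[OF w])
  obtain m where m: "\<gamma> \<bullet> coroot \<alpha> = of_int m" using cartan_integer[OF Cons.prems(2) ga] .
  let ?\<alpha> = "\<sigma> \<gamma> \<alpha>" and ?k = "k - j * m"
  have r: "?\<alpha> \<in> \<Phi>" by (rule refl_root[OF ga Cons.prems(2)])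
  show ?case
  proof (cases "form ?\<alpha> ?k (- \<rho>) < 0")
    case True
    have "form ?\<alpha> ?k (prod_word ws (- \<rho>)) \<ge> 0"
      using Cons.prems(4) by (simp add: g wall_form_affine_reflection[OF m])
    then obtain vs where vs: "set vs \<subseteq> generators" "length vs < length ws"
      "s_aff ?\<alpha> ?k \<circ> prod_word ws = prod_word vs"
      using Cons.IH[OF gg(2) r True] by blast
    have "(s_aff \<alpha> k \<circ> prod_word (g # ws)) y = prod_word (g # vs) y" for y
      using fun_cong[OF vs(3), of y] by (simp add: g affine_reflection_conjugate[OF m])
    then have "s_aff \<alpha> k \<circ> prod_word (g # ws) = prod_word (g # vs)" by blast
    moreover have "set (g # vs) \<subseteq> generators" "length (g # vs) < length (g # ws)"
      using vs(1,2) gg by simp_all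
    ultimately show ?thesis by blast
  next
    case False
    then have "form ?\<alpha> ?k (- \<rho>) > 0" using form_nonzero[OF r] by (simp add: less_le)
    then have "form \<alpha> k (s_aff \<gamma> j (- \<rho>)) > 0" by (simp add: wall_form_affine_reflection[OF m])
    then have "\<alpha> = - \<gamma> \<and> k = - j" using flip_only_own_wall[OF w Cons.prems(2,3)] by blast
    then have "s_aff \<alpha> k = g" by (simp add: affine_reflection_minus g)
    then have "s_aff \<alpha> k \<circ> prod_word (g # ws) = prod_word ws"
      by (simp add: fun_eq_iff g s_aff_s_aff[OF ga])
    moreover have "length ws < length (g # ws)" by simp
    ultimately show ?thesis using gg(2) by blast
  qed
qed

text \<open>If no negative simple root makes an acute angle with \<open>\<alpha>\<close>, then \<open>\<alpha>\<close> is dominant, and two dominant roots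
make an acute angle.\<close>

lemma ex_acute_simple_wall:
  assumes "\<alpha> \<in> \<Phi>" shows "\<exists>\<gamma> j. (\<gamma>, j) \<in> simple_walls \<and> \<gamma> \<bullet> \<alpha> > 0"
proof (cases "\<exists>\<delta>\<in>\<Delta>. \<alpha> \<bullet> \<delta> < 0")
  case True
  then obtain \<delta> where "\<delta> \<in> \<Delta>" "(- \<delta>) \<bullet> \<alpha> > 0" by (auto simp: inner_commute)
  then show ?thesis by (intro exI[of _ "- \<delta>"] exI[of _ 0]) (simp add: simple_walls_def)
next
  case False
  then have "\<alpha>0 \<bullet> \<alpha> > 0"
    using assms by (intro dominant_roots_acute short_root short_dominant) (simp_all add: not_less)
  then show ?thesis by (intro exI[of _ \<alpha>0] exI[of _ "- 1"]) (simp add: simple_walls_def)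
qed

text \<open>Descent on the value of the affine root at \<open>- \<rho>\<close>, a positive integer. Reflecting in a wall at an acute
angle lowers the value, and keeps it positive unless the affine root is that of the wall.\<close>

lemma affine_reflection_word_pos:
  assumes "\<alpha> \<in> \<Phi>" "form \<alpha> k (- \<rho>) > 0"
  shows "\<exists>ws. set ws \<subseteq> generators \<and> s_aff \<alpha> k = prod_word ws"
  using assms
proof (induction "nat \<lfloor>form \<alpha> k (- \<rho>)\<rfloor>" arbitrary: \<alpha> k rule: less_induct)
  case less
  have int: "form \<beta> i (- \<rho>) \<in> \<int>" if "\<beta> \<in> \<Phi>" for \<beta> i
    using rho_weight[OF that] by (simp add: wall_form_def)
  obtain \<gamma> j where w: "(\<gamma>, j) \<in> simple_walls" and ac: "\<gamma> \<bullet> \<alpha> > 0"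
    using ex_acute_simple_wall[OF less.prems(1)] by blast
  have ga: "\<gamma> \<in> \<Phi>" by (rule simple_wall_root[OF w])
  obtain m where m: "\<gamma> \<bullet> coroot \<alpha> = of_int m" using cartan_integer[OF less.prems(1) ga] .
  have mp: "m > 0" using ac m inner_coroot_sign(1)[OF root_nonzero[OF less.prems(1)], of \<gamma>] by simp
  let ?\<alpha> = "\<sigma> \<gamma> \<alpha>" and ?k = "k - j * m"
  have r: "?\<alpha> \<in> \<Phi>" by (rule refl_root[OF ga less.prems(1)])
  have e: "form ?\<alpha> ?k y = form \<alpha> k (s_aff \<gamma> j y)" for y
    by (simp add: wall_form_affine_reflection[OF m])
  show ?case
  proof (cases "\<alpha> = \<gamma> \<and> k = j")
    case True
    then show ?thesis using simple_wall_generator[OF w] by (intro exI[of _ "[s_aff \<gamma> j]"]) (simp add: fun_eq_iff)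
  next
    case False
    have pos: "form ?\<alpha> ?k (- \<rho>) > 0"
    proof (rule ccontr)
      assume "\<not> form ?\<alpha> ?k (- \<rho>) > 0"
      then have "form ?\<alpha> ?k (- \<rho>) < 0" using form_nonzero[OF r] by (simp add: less_le not_less)
      then have "form (- \<alpha>) (- k) (s_aff \<gamma> j (- \<rho>)) > 0" unfolding e by (simp add: wall_form_minus)
      moreover have "form (- \<alpha>) (- k) (- \<rho>) < 0" using less.prems(2) by (simp add: wall_form_minus)
      ultimately have "- \<alpha> = - \<gamma> \<and> - k = - j"
        using flip_only_own_wall[OF w minus_root[OF less.prems(1)]] by blast
      then show False using False by simp
    qed
    have "form ?\<alpha> ?k (- \<rho>) = form \<alpha> k (- \<rho>) - form \<gamma> j (- \<rho>) * of_int m"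
      unfolding e affine_reflection_wall_form[of ell \<gamma>]
      by (simp add: wall_form_def[of ell \<alpha>] inner_diff_left m)
    moreover have "form \<gamma> j (- \<rho>) * of_int m > 0" using simple_wall_pos[OF w] mp by simp
    ultimately have lt: "form ?\<alpha> ?k (- \<rho>) < form \<alpha> k (- \<rho>)" by simp
    obtain a b where "form ?\<alpha> ?k (- \<rho>) = of_int a" "form \<alpha> k (- \<rho>) = of_int b"
      using int[OF r] int[OF less.prems(1)] Ints_cases by metis
    then have "nat \<lfloor>form ?\<alpha> ?k (- \<rho>)\<rfloor> < nat \<lfloor>form \<alpha> k (- \<rho>)\<rfloor>" using lt pos by simp
    from less.hyps[OF this r pos] obtain ws where ws: "set ws \<subseteq> generators" "s_aff ?\<alpha> ?k = prod_word ws"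
      by blast
    have "s_aff \<alpha> k y = prod_word (s_aff \<gamma> j # ws @ [s_aff \<gamma> j]) y" for y
      using affine_reflection_conjugate[OF m, of ell k j "s_aff \<gamma> j y"]
      by (simp add: s_aff_s_aff[OF ga] ws(2))
    then show ?thesis using ws(1) simple_wall_generator[OF w]
      by (intro exI[of _ "s_aff \<gamma> j # ws @ [s_aff \<gamma> j]"]) (simp add: fun_eq_iff)
  qed
qed

lemma affine_reflection_word:
  assumes "\<alpha> \<in> \<Phi>" shows "\<exists>ws. set ws \<subseteq> generators \<and> s_aff \<alpha> k = prod_word ws"
proof (cases "form \<alpha> k (- \<rho>) > 0")
  case True then show ?thesis by (rule affine_reflection_word_pos[OF assms])
next
  case False
  then have "form (- \<alpha>) (- k) (- \<rho>) > 0"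
    using form_nonzero[OF assms, of k] by (simp add: wall_form_minus)
  from affine_reflection_word_pos[OF minus_root[OF assms] this]
  show ?thesis by (simp add: affine_reflection_minus)
qed

lemma affine_weyl_group_word:
  assumes "w \<in> affine_weyl_group \<Phi> ell"
  shows "\<exists>ws. set ws \<subseteq> generators \<and> w = prod_word ws"
  using assms unfolding affine_weyl_group_def
proof (induction rule: generate_BijGroup_induct)
  case (bij g)
  then show ?case using bij_involution[of g] s_aff_s_aff by blast
next
  case one
  show ?case by (intro exI[of _ "[]"]) (simp add: fun_eq_iff)
next
  case (generator g)
  then show ?case using affine_reflection_word by blast
next
  case (inverse g)
  then obtain \<alpha> r where "g = s_aff \<alpha> r" "\<alpha> \<in> \<Phi>" by blast
  then show ?case using inv_involution[of g] s_aff_s_aff[of \<alpha> r] affine_reflection_word[of \<alpha> r] by metis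
next
  case (mult f g)
  then obtain us vs where "set us \<subseteq> generators" "f = prod_word us" "set vs \<subseteq> generators" "g = prod_word vs"
    by blast
  then show ?case by (intro exI[of _ "us @ vs"]) (simp add: fun_eq_iff)
qed

lemma affine_weyl_group_mult_reflection:
  assumes "w \<in> affine_weyl_group \<Phi> ell" "\<alpha> \<in> \<Phi>"
  shows "s_aff \<alpha> k \<circ> w \<in> affine_weyl_group \<Phi> ell"
proof -
  have bij_s: "bij (s_aff \<beta> i)" if "\<beta> \<in> \<Phi>" for \<beta> i
    using bij_involution[of "s_aff \<beta> i"] s_aff_s_aff[OF that] by blast
  have "bij w"
    using assms(1) unfolding affine_weyl_group_def
  proof (induction rule: generate_BijGroup_induct)
    case (inverse g) then show ?case using bij_s bij_imp_bij_inv by blast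
  next
    case (mult f g) then show ?case using bij_comp by blast
  next
    case one show ?case by (rule bij_id)
  qed (use bij_s in blast)+
  then have "s_aff \<alpha> k \<circ> w = s_aff \<alpha> k \<otimes>\<^bsub>BijGroup UNIV\<^esub> w"
    using BijGroup_UNIV_mult[OF bij_s[OF assms(2)]] by simp
  also have "\<dots> \<in> affine_weyl_group \<Phi> ell"
    unfolding affine_weyl_group_def
    by (rule generate.eng[OF generate.incl assms(1)[unfolded affine_weyl_group_def]]) (use assms(2) in blast)
  finally show ?thesis .
qed

lemma coxeter_length_le:
  assumes "set ws \<subseteq> generators" shows "coxeter_length \<Delta> \<alpha>0 ell (prod_word ws) \<le> length ws"
  unfolding coxeter_length_def by (rule Least_le) (use assms prod_word_def in blast)

lemma reduced_word:
  assumes "w \<in> affine_weyl_group \<Phi> ell"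
  obtains ws where "set ws \<subseteq> generators" "w = prod_word ws" "length ws = coxeter_length \<Delta> \<alpha>0 ell w"
proof -
  obtain vs where "set vs \<subseteq> generators" "w = prod_word vs" using affine_weyl_group_word[OF assms] by blast
  then have "\<exists>ws. length ws = length vs \<and> set ws \<subseteq> generators \<and> w = foldr (\<circ>) ws id"
    unfolding prod_word_def by blast
  then have "\<exists>ws. length ws = coxeter_length \<Delta> \<alpha>0 ell w \<and> set ws \<subseteq> generators \<and> w = foldr (\<circ>) ws id"
    unfolding coxeter_length_def by (rule LeastI)
  then show ?thesis using that unfolding prod_word_def by blast
qed

text \<open>The linear part of a word is a product of reflections, one for each letter.\<close>

lemma word_alternant:
  assumes "set ws \<subseteq> generators"
  shows "\<exists>L c. linear L \<and> (\<forall>y. prod_word ws y = L y + c) \<and>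
    (\<forall>u. alternant (L u) = (- 1) ^ length ws * alternant u)"
  using assms
proof (induction ws)
  case Nil
  show ?case by (intro exI[of _ "\<lambda>y. y"] exI[of _ 0]) (simp add: linear_ident)
next
  case (Cons g ws)
  then obtain L c where L: "linear L" "\<And>y. prod_word ws y = L y + c"
    "\<And>u. alternant (L u) = (- 1) ^ length ws * alternant u" by auto
  obtain \<gamma> j where w: "(\<gamma>, j) \<in> simple_walls" and g: "g = s_aff \<gamma> j"
    using generator_cases[of g] Cons.prems by auto
  have "linear (\<lambda>y. \<sigma> \<gamma> (L y))"
    using linear_compose[OF L(1) linear_root_reflection[of \<gamma>]] by (simp add: comp_def)
  moreover have "prod_word (g # ws) y = \<sigma> \<gamma> (L y) + (\<sigma> \<gamma> c + (of_int j * of_nat ell) *\<^sub>R \<gamma>)" for y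
    by (simp add: L(2) g affine_reflection_linear_part linear_add[OF linear_root_reflection])
  moreover have "alternant (\<sigma> \<gamma> (L u)) = (- 1) ^ length (g # ws) * alternant u" for u
    by (simp add: L(3) alternant_reflection[OF simple_wall_root[OF w]])
  ultimately show ?case by blast
qed

end

section \<open>Minimal dominant elements\<close>

context based_root_system
begin

lemma weyl_group_orthogonal:
  assumes "x \<in> weyl_group \<Phi>"
  shows "orthogonal_transformation x \<and> x ` \<Phi> = \<Phi>"
  using assms unfolding weyl_group_def
proof (induction rule: generate_BijGroup_induct)
  case (bij g)
  then show ?case using bij_involution[of g] root_reflection_involution by blast
next
  case one
  show ?case using orthogonal_transformation_id by (simp add: id_def)
next
  case (generator g)
  then show ?case using refl_image linear_root_reflection inner_root_reflection
    unfolding orthogonal_transformation_def by blast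
next
  case (inverse g)
  then have "inv_into UNIV g = g" using inv_involution[of g] root_reflection_involution by blast
  then show ?case using inverse refl_image linear_root_reflection inner_root_reflection
    unfolding orthogonal_transformation_def by auto
next
  case (mult f g)
  then show ?case using orthogonal_transformation_compose[of f g] image_comp[of f g \<Phi>] by metis
qed

end

locale minimal_dominant_element = affine_root_system +
  fixes \<mu>m \<theta> :: 'a and w x :: "'a \<Rightarrow> 'a"
  assumes alcove: "\<mu>m \<in> closed_antidominant_alcove_weights \<Phi> \<Delta> ell"
    and theta: "\<theta> \<in> root_lattice \<Phi>"
    and weyl: "x \<in> weyl_group \<Phi>"
    and w_def: "w = translation (of_nat ell *\<^sub>R \<theta>) \<circ> x"
    and minimal: "minimal_dominant \<Phi> \<Delta> \<alpha>0 ell \<mu>m w"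
begin

definition "\<mu> = dot_action \<Phi> \<Delta> w \<mu>m"
definition "u = \<mu>m + \<rho>"
definition "v = \<mu> + \<rho>"
definition "y = inv_into UNIV x"

lemma w_apply: "w z = x z + of_nat ell *\<^sub>R \<theta>"
  by (simp add: w_def translation_def)

lemma v_eq: "v = w u"
  by (simp add: v_def u_def \<mu>_def dot_action_def)

lemma orth_x: "orthogonal_transformation x" and image_x: "x ` \<Phi> = \<Phi>"
  using weyl_group_orthogonal[OF weyl] by blast+

lemma linear_x: "linear x"
  using orth_x by (rule orthogonal_transformation_linear)

lemma x_y: "x (y z) = z"
  unfolding y_def by (rule surj_f_inv_f[OF orthogonal_transformation_surj[OF orth_x]])

lemma y_x: "y (x z) = z"
  unfolding y_def by (rule inv_f_f[OF orthogonal_transformation_inj[OF orth_x]])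

lemma orth_y: "orthogonal_transformation y"
  unfolding y_def by (rule orthogonal_transformation_inv[OF orth_x])

lemma linear_y: "linear y"
  using orth_y by (rule orthogonal_transformation_linear)

lemma y_minus: "y (- z) = - y z"
  by (rule linear_neg[OF linear_y])

lemma inj_y: "inj_on y A"
  using inj_on_subset[OF orthogonal_transformation_inj[OF orth_y] subset_UNIV] .

lemma image_y: "y ` \<Phi> = \<Phi>"
proof -
  have "y ` (x ` \<Phi>) = \<Phi>" by (simp add: image_image y_x)
  then show ?thesis by (simp add: image_x)
qed

lemma y_root: "\<alpha> \<in> \<Phi> \<Longrightarrow> y \<alpha> \<in> \<Phi>" and x_root: "\<alpha> \<in> \<Phi> \<Longrightarrow> x \<alpha> \<in> \<Phi>"
  using image_y image_x by blast+

lemma inner_x: "x a \<bullet> b = a \<bullet> y b"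
proof -
  have "x a \<bullet> x (y b) = a \<bullet> y b"
    using orth_x unfolding orthogonal_transformation_def by blast
  then show ?thesis by (simp add: x_y)
qed

lemma inner_y: "y a \<bullet> y b = a \<bullet> b"
  using orth_y unfolding orthogonal_transformation_def by blast

lemma inner_x_coroot: "x a \<bullet> coroot b = a \<bullet> coroot (y b)"
  by (simp add: inner_coroot inner_x inner_y)

lemma theta_int:
  assumes "\<alpha> \<in> \<Phi>" shows "\<theta> \<bullet> coroot \<alpha> \<in> \<int>"
proof -
  obtain c :: "'a \<Rightarrow> int" where "\<theta> = (\<Sum>\<beta>\<in>\<Phi>. of_int (c \<beta>) *\<^sub>R \<beta>)"
    using theta unfolding root_lattice_def by blast
  then have "\<theta> \<bullet> coroot \<alpha> = (\<Sum>\<beta>\<in>\<Phi>. of_int (c \<beta>) * (\<beta> \<bullet> coroot \<alpha>))"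
    by (simp add: inner_sum_left)
  also have "\<dots> \<in> \<int>" using cartan_int[OF assms] by (intro Ints_sum Ints_mult Ints_of_int)
  finally show ?thesis .
qed

lemma u_int:
  assumes "\<alpha> \<in> \<Phi>" shows "u \<bullet> coroot \<alpha> \<in> \<int>"
proof -
  have "\<mu>m \<bullet> coroot \<alpha> \<in> \<int>"
    using alcove assms unfolding closed_antidominant_alcove_weights_def weight_lattice_def by blast
  then show ?thesis using rho_weight[OF assms] by (simp add: u_def inner_add_left)
qed

lemma u_alcove: "\<beta> \<in> P \<Longrightarrow> - real ell \<le> u \<bullet> coroot \<beta>" "\<beta> \<in> P \<Longrightarrow> u \<bullet> coroot \<beta> \<le> 0"
  using alcove unfolding closed_antidominant_alcove_weights_def u_def by auto

lemma v_pairing: "v \<bullet> coroot \<alpha> = u \<bullet> coroot (y \<alpha>) + real ell * (\<theta> \<bullet> coroot \<alpha>)"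
  by (simp add: v_eq w_apply inner_add_left inner_x_coroot)

lemma v_int: "\<alpha> \<in> \<Phi> \<Longrightarrow> v \<bullet> coroot \<alpha> \<in> \<int>"
  unfolding v_pairing by (intro Ints_add Ints_mult u_int y_root theta_int) simp_all

lemma v_pos:
  assumes "\<beta> \<in> P" shows "v \<bullet> \<beta> > 0"
proof (rule inner_pos_root_pos[OF _ assms])
  fix \<delta> assume d: "\<delta> \<in> \<Delta>"
  have "\<mu> \<bullet> coroot \<delta> \<ge> 0"
    using minimal d unfolding minimal_dominant_def dominant_weights_def \<mu>_def by blast
  then have "v \<bullet> coroot \<delta> > 0" using rho_simple[OF d] by (simp add: v_def inner_add_left)
  then show "v \<bullet> \<delta> > 0" using inner_coroot_sign(1)[OF root_nonzero[OF simple_root[OF d]]] by blast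
qed

abbreviation "singular \<equiv> singular_roots \<Phi> \<Delta> ell"
abbreviation "singular_pos \<equiv> singular_pos_roots \<Phi> \<Delta> ell"

lemma singular_iff:
  "\<alpha> \<in> singular \<mu> \<longleftrightarrow> \<alpha> \<in> \<Phi> \<and> (\<exists>k::int. v \<bullet> coroot \<alpha> = of_int k * real ell)"
  "\<alpha> \<in> singular \<mu>m \<longleftrightarrow> \<alpha> \<in> \<Phi> \<and> (\<exists>k::int. u \<bullet> coroot \<alpha> = of_int k * real ell)"
  by (auto simp: singular_roots_def v_def u_def)

lemma singular_minus:
  "- \<alpha> \<in> singular \<mu> \<longleftrightarrow> \<alpha> \<in> singular \<mu>" "- \<alpha> \<in> singular \<mu>m \<longleftrightarrow> \<alpha> \<in> singular \<mu>m"
proof -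
  have "(\<exists>k::int. - (r::real) = of_int k * real ell) \<longleftrightarrow> (\<exists>k::int. r = of_int k * real ell)" for r
    by (rule iffI; elim exE; rule_tac x = "- k" in exI) simp_all
  then show "- \<alpha> \<in> singular \<mu> \<longleftrightarrow> \<alpha> \<in> singular \<mu>" "- \<alpha> \<in> singular \<mu>m \<longleftrightarrow> \<alpha> \<in> singular \<mu>m"
    by (simp_all add: singular_iff)
qed

lemma singular_y:
  assumes "\<alpha> \<in> \<Phi>" shows "y \<alpha> \<in> singular \<mu>m \<longleftrightarrow> \<alpha> \<in> singular \<mu>"
proof -
  obtain t where t: "\<theta> \<bullet> coroot \<alpha> = of_int t" using theta_int[OF assms] by (rule Ints_cases)
  have "(\<exists>k::int. u \<bullet> coroot (y \<alpha>) = of_int k * real ell) \<longleftrightarrow>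
      (\<exists>k::int. v \<bullet> coroot \<alpha> = of_int k * real ell)"
  proof
    assume "\<exists>k::int. u \<bullet> coroot (y \<alpha>) = of_int k * real ell"
    then obtain k :: int where "u \<bullet> coroot (y \<alpha>) = of_int k * real ell" ..
    then show "\<exists>k::int. v \<bullet> coroot \<alpha> = of_int k * real ell"
      by (intro exI[of _ "k + t"]) (simp add: v_pairing t algebra_simps)
  next
    assume "\<exists>k::int. v \<bullet> coroot \<alpha> = of_int k * real ell"
    then obtain k :: int where "v \<bullet> coroot \<alpha> = of_int k * real ell" ..
    then show "\<exists>k::int. u \<bullet> coroot (y \<alpha>) = of_int k * real ell"
      by (intro exI[of _ "k - t"]) (simp add: v_pairing t algebra_simps)
  qed
  then show ?thesis using assms y_root by (simp add: singular_iff)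
qed

text \<open>Minimality of \<open>w\<close>: otherwise the reflection in the hyperplane would fix \<open>v\<close> and, by \<open>deletion\<close>, shorten
\<open>w\<close>. The affine root is negative at \<open>- \<rho>\<close> because \<open>v\<close>, being strictly dominant, has \<open>k > 0\<close>.\<close>

lemma not_separated_by_wall:
  assumes a: "\<alpha> \<in> P" and k: "v \<bullet> coroot \<alpha> = of_int k * real ell"
  shows "form \<alpha> k (w (- \<rho>)) < 0"
proof (rule ccontr)
  assume "\<not> form \<alpha> k (w (- \<rho>)) < 0"
  then have nn: "form \<alpha> k (w (- \<rho>)) \<ge> 0" by simp
  have "v \<bullet> coroot \<alpha> > 0"
    using v_pos[OF a] inner_coroot_sign(1)[OF root_nonzero[OF pos_root[OF a]]] by blast
  then have "k > 0" unfolding k using ell_pos by (simp add: zero_less_mult_iff)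
  then have neg: "form \<alpha> k (- \<rho>) < 0" using form_pos_root(2)[OF a] by simp
  have wW: "w \<in> affine_weyl_group \<Phi> ell" using minimal unfolding minimal_dominant_def by blast
  obtain ws where ws: "set ws \<subseteq> generators" "w = prod_word ws"
    "length ws = coxeter_length \<Delta> \<alpha>0 ell w" using reduced_word[OF wW] .
  obtain vs where vs: "set vs \<subseteq> generators" "length vs < length ws" "s_aff \<alpha> k \<circ> w = prod_word vs"
    using deletion[OF ws(1) pos_root[OF a] neg] nn unfolding ws(2) by blast
  have "form \<alpha> k v = 0" using k by (simp add: wall_form_def)
  then have "s_aff \<alpha> k (w u) = w u" by (simp add: affine_reflection_wall_form v_eq)
  then have "dot_action \<Phi> \<Delta> (s_aff \<alpha> k \<circ> w) \<mu>m = dot_action \<Phi> \<Delta> w \<mu>m"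
    by (simp add: dot_action_def u_def)
  then have "coxeter_length \<Delta> \<alpha>0 ell w \<le> coxeter_length \<Delta> \<alpha>0 ell (s_aff \<alpha> k \<circ> w)"
    using minimal affine_weyl_group_mult_reflection[OF wW pos_root[OF a]]
    unfolding minimal_dominant_def by blast
  also have "\<dots> \<le> length vs" unfolding vs(3) by (rule coxeter_length_le[OF vs(1)])
  finally show False using vs(2) ws(3) by simp
qed

text \<open>The affine root of \<open>(\<alpha>, k)\<close> vanishes at \<open>v = w u\<close> and is negative at \<open>w (- \<rho>)\<close>, so the coroot of \<open>y \<alpha>\<close>
takes a larger value at \<open>u\<close> than at \<open>- \<rho>\<close>. At \<open>u\<close> the value is a multiple of \<open>ell\<close> between \<open>- ell\<close> and 0, or
between 0 and \<open>ell\<close>, according to the sign of \<open>y \<alpha>\<close>; at \<open>- \<rho>\<close> it lies strictly inside that interval.\<close>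

lemma singular_preimage:
  assumes a: "\<alpha> \<in> singular_pos \<mu>"
  shows "y \<alpha> \<in> P \<Longrightarrow> u \<bullet> coroot (y \<alpha>) = 0"
    and "y \<alpha> \<notin> P \<Longrightarrow> u \<bullet> coroot (- y \<alpha>) = - real ell"
proof -
  have aP: "\<alpha> \<in> P" and aS: "\<alpha> \<in> singular \<mu>" using a unfolding singular_pos_roots_def by blast+
  have aR: "\<alpha> \<in> \<Phi>" by (rule pos_root[OF aP])
  obtain k :: int where k: "v \<bullet> coroot \<alpha> = of_int k * real ell" using aS singular_iff by blast
  obtain i :: int where i: "u \<bullet> coroot (y \<alpha>) = of_int i * real ell"
    using aS singular_y[OF aR] singular_iff by blast
  have "form \<alpha> k (w (- \<rho>)) = (x (- \<rho>) - x u) \<bullet> coroot \<alpha>"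
    using k by (simp add: wall_form_def v_eq w_apply inner_diff_left inner_add_left)
  also have "\<dots> = - (\<rho> \<bullet> coroot (y \<alpha>)) - u \<bullet> coroot (y \<alpha>)"
    by (simp add: inner_diff_left inner_x_coroot)
  finally have lt: "- (\<rho> \<bullet> coroot (y \<alpha>)) < of_int i * real ell"
    using not_separated_by_wall[OF aP k] i by simp
  have l: "real ell > 0" using ell_pos by simp
  {
    assume p: "y \<alpha> \<in> P"
    have "of_int (- 1) * real ell < of_int i * real ell" "of_int i * real ell \<le> of_int 0 * real ell"
      using lt rho_coroot_less[OF p] u_alcove(2)[OF p] i by simp_all
    then have "i = 0" using l by (simp only: mult_less_cancel_right_pos mult_le_cancel_right_pos of_int_less_iff of_int_le_iff)
    then show "u \<bullet> coroot (y \<alpha>) = 0" using i by simp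
  }
  {
    assume "y \<alpha> \<notin> P"
    then have p: "- y \<alpha> \<in> P" using pos_or_neg[OF y_root[OF aR]] by blast
    have "of_int 0 * real ell < of_int i * real ell" "of_int i * real ell \<le> of_int 1 * real ell"
      using lt rho_coroot_pos[OF p] u_alcove(1)[OF p] i by simp_all
    then have "i = 1" using l by (simp only: mult_less_cancel_right_pos mult_le_cancel_right_pos of_int_less_iff of_int_le_iff)
    then show "u \<bullet> coroot (- y \<alpha>) = - real ell" using i by simp
  }
qed

text \<open>The map \<open>\<alpha> \<mapsto> - y \<alpha>\<close> is a bijection by \<open>singular_preimage\<close>: a root pairing to \<open>- ell\<close> with \<open>u\<close> cannot be
the image \<open>y \<alpha>\<close> of a positive singular \<open>\<alpha>\<close>.\<close>

lemma card_singular_sign_changes: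
  "card {\<alpha> \<in> singular_pos \<mu>. y \<alpha> \<notin> P} =
   card {\<beta> \<in> singular_pos \<mu>m. u \<bullet> coroot \<beta> = - real ell}"
proof (rule bij_betw_same_card[of "\<lambda>\<alpha>. - y \<alpha>"], rule bij_betwI[where g = "\<lambda>\<beta>. - x \<beta>"])
  show "(\<lambda>\<alpha>. - y \<alpha>) \<in> {\<alpha> \<in> singular_pos \<mu>. y \<alpha> \<notin> P} \<rightarrow>
      {\<beta> \<in> singular_pos \<mu>m. u \<bullet> coroot \<beta> = - real ell}"
  proof
    fix \<alpha> assume "\<alpha> \<in> {\<alpha> \<in> singular_pos \<mu>. y \<alpha> \<notin> P}"
    then have a: "\<alpha> \<in> singular_pos \<mu>" "y \<alpha> \<notin> P" by simp_all
    then have "\<alpha> \<in> \<Phi>" "\<alpha> \<in> singular \<mu>" using pos_root unfolding singular_pos_roots_def by blast+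
    then show "- y \<alpha> \<in> {\<beta> \<in> singular_pos \<mu>m. u \<bullet> coroot \<beta> = - real ell}"
      using singular_preimage(2)[OF a] singular_y[of \<alpha>] singular_minus(2)[of "y \<alpha>"]
        pos_or_neg[OF y_root[of \<alpha>]] a(2) unfolding singular_pos_roots_def by simp
  qed
  show "(\<lambda>\<beta>. - x \<beta>) \<in> {\<beta> \<in> singular_pos \<mu>m. u \<bullet> coroot \<beta> = - real ell} \<rightarrow>
      {\<alpha> \<in> singular_pos \<mu>. y \<alpha> \<notin> P}"
  proof
    fix \<beta> assume "\<beta> \<in> {\<beta> \<in> singular_pos \<mu>m. u \<bullet> coroot \<beta> = - real ell}"
    then have b: "\<beta> \<in> P" "\<beta> \<in> singular \<mu>m" "u \<bullet> coroot \<beta> = - real ell"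
      unfolding singular_pos_roots_def by simp_all
    have xb: "x \<beta> \<in> \<Phi>" by (rule x_root[OF pos_root[OF b(1)]])
    have s: "x \<beta> \<in> singular \<mu>" using singular_y[OF xb] b(2) by (simp add: y_x)
    have "x \<beta> \<notin> P"
    proof
      assume "x \<beta> \<in> P"
      then have "x \<beta> \<in> singular_pos \<mu>" using s unfolding singular_pos_roots_def by simp
      then show False using singular_preimage(1)[of "x \<beta>"] b ell_pos by (simp add: y_x)
    qed
    then have "- x \<beta> \<in> singular_pos \<mu>"
      using pos_or_neg[OF xb] s singular_minus(1)[of "x \<beta>"] unfolding singular_pos_roots_def by blast
    then show "- x \<beta> \<in> {\<alpha> \<in> singular_pos \<mu>. y \<alpha> \<notin> P}"
      using neg_not_pos[OF b(1)] by (simp add: y_minus y_x)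
  qed
qed (simp_all add: linear_neg[OF linear_x] x_y y_minus y_x)

text \<open>Both numbers measure the sign by which \<open>x\<close> acts on the alternant. The first computation uses a reduced
word of \<open>w\<close>, whose linear part is \<open>x\<close>; the second moves \<open>x\<close> to the roots. They are compared at \<open>\<rho>\<close>, where
the alternant does not vanish.\<close>

lemma parity_length:
  "even (coxeter_length \<Delta> \<alpha>0 ell w) \<longleftrightarrow> even (card {\<alpha> \<in> P. y \<alpha> \<notin> P})"
proof -
  have wW: "w \<in> affine_weyl_group \<Phi> ell" using minimal unfolding minimal_dominant_def by blast
  obtain ws where ws: "set ws \<subseteq> generators" "w = prod_word ws"
    "length ws = coxeter_length \<Delta> \<alpha>0 ell w" using reduced_word[OF wW] .
  obtain L c where L: "linear L" "\<And>z. w z = L z + c"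
    "\<And>z. alternant (L z) = (- 1) ^ length ws * alternant z"
    using word_alternant[OF ws(1)] unfolding ws(2) by blast
  have "c = of_nat ell *\<^sub>R \<theta>"
    using L(2)[of 0] w_apply[of 0] linear_0[OF L(1)] linear_0[OF linear_x] by simp
  then have "L \<rho> = x \<rho>" using L(2)[of \<rho>] w_apply[of \<rho>] by simp
  then have 1: "alternant (x \<rho>) = (- 1) ^ length ws * alternant \<rho>" using L(3)[of \<rho>] by simp
  have PX: "\<Phi> \<inter> P = P" using pos_root by blast
  have "alternant (x \<rho>) = (\<Prod>\<alpha>\<in>\<Phi> \<inter> P. \<rho> \<bullet> y \<alpha>)" by (simp add: alternant_def inner_x PX)
  also have "\<dots> = (- 1) ^ card {\<alpha> \<in> \<Phi> \<inter> P. y \<alpha> \<notin> P} * (\<Prod>\<beta>\<in>y ` \<Phi> \<inter> P. \<rho> \<bullet> \<beta>)"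
    by (rule prod_odd_function) (simp_all add: inj_y image_y y_minus)
  also have "\<dots> = (- 1) ^ card {\<alpha> \<in> P. y \<alpha> \<notin> P} * alternant \<rho>"
    by (simp add: image_y PX alternant_def)
  finally have "(- 1 :: real) ^ length ws = (- 1) ^ card {\<alpha> \<in> P. y \<alpha> \<notin> P}"
    using 1 alternant_rho by simp
  then show ?thesis unfolding ws(3)[symmetric] by (simp add: minus_one_power_iff split: if_splits)
qed

end

section \<open>The Laurent polynomial at a root of unity\<close>

context minimal_dominant_element
begin

lemma root_exponent:
  assumes "\<alpha> \<in> \<Phi>"
  shows "of_int (root_exponent \<Phi> \<Delta> \<mu> \<alpha>) = half_norm \<alpha> * (v \<bullet> coroot \<alpha>)"
    "of_int (root_exponent \<Phi> \<Delta> \<mu>m \<alpha>) = half_norm \<alpha> * (u \<bullet> coroot \<alpha>)"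
proof -
  have "half_norm \<alpha> * (v \<bullet> coroot \<alpha>) \<in> \<int>" "half_norm \<alpha> * (u \<bullet> coroot \<alpha>) \<in> \<int>"
    by (intro Ints_mult half_norm_int v_int u_int assms)+
  then show "of_int (root_exponent \<Phi> \<Delta> \<mu> \<alpha>) = half_norm \<alpha> * (v \<bullet> coroot \<alpha>)"
    "of_int (root_exponent \<Phi> \<Delta> \<mu>m \<alpha>) = half_norm \<alpha> * (u \<bullet> coroot \<alpha>)"
    unfolding root_exponent_def v_def[symmetric] u_def[symmetric] by (auto elim!: Ints_cases)
qed

lemma root_exponent_minus:
  assumes "\<alpha> \<in> \<Phi>" shows "root_exponent \<Phi> \<Delta> \<mu>m (- \<alpha>) = - root_exponent \<Phi> \<Delta> \<mu>m \<alpha>"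
proof -
  have "real_of_int (root_exponent \<Phi> \<Delta> \<mu>m (- \<alpha>)) = real_of_int (- root_exponent \<Phi> \<Delta> \<mu>m \<alpha>)"
    using root_exponent(2)[OF assms] root_exponent(2)[OF minus_root[OF assms]]
    by (simp add: half_norm_def)
  then show ?thesis by (simp only: of_int_eq_iff)
qed

text \<open>The translation part contributes \<open>ell \<langle>\<theta>, \<alpha>\<rangle>\<close>, an integral multiple of \<open>ell\<close>.\<close>

lemma root_exponent_congruent:
  assumes "\<alpha> \<in> \<Phi>"
  shows "\<exists>t. root_exponent \<Phi> \<Delta> \<mu> \<alpha> = root_exponent \<Phi> \<Delta> \<mu>m (y \<alpha>) + int ell * t"
proof -
  have "half_norm \<alpha> * (\<theta> \<bullet> coroot \<alpha>) \<in> \<int>"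
    by (intro Ints_mult half_norm_int theta_int assms)
  then obtain t where t: "half_norm \<alpha> * (\<theta> \<bullet> coroot \<alpha>) = of_int t" by (rule Ints_cases)
  have "half_norm (y \<alpha>) = half_norm \<alpha>" by (simp add: half_norm_def inner_y)
  then have "real_of_int (root_exponent \<Phi> \<Delta> \<mu> \<alpha>) =
      real_of_int (root_exponent \<Phi> \<Delta> \<mu>m (y \<alpha>) + int ell * t)"
    using root_exponent(1)[OF assms] root_exponent(2)[OF y_root[OF assms]]
    by (simp add: v_pairing distrib_left flip: t)
  then show ?thesis unfolding of_int_eq_iff ..
qed

end

locale root_of_unity_setting = minimal_dominant_element +
  fixes \<zeta> :: complex
  assumes odd_ell: "odd ell"
    and good: "\<forall>p. bad_prime \<Delta> p \<longrightarrow> coprime ell p"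
    and primitive: "primitive_root_of_unity ell \<zeta>"
begin

lemma zeta_nonzero: "\<zeta> \<noteq> 0"
  using primitive unfolding primitive_root_of_unity_def
  by (metis power_0_left zero_neq_one not_gr_zero)

text \<open>The numbers 1 and 2 are harmless as \<open>ell\<close> is odd; 3 occurs only in type \<open>G\<^sub>2\<close>, for which it is a bad
prime.\<close>

lemma half_norm_coprime:
  assumes "\<alpha> \<in> \<Phi>" obtains d where "half_norm \<alpha> = of_int d" "coprime (int ell) d"
proof -
  have "coprime (int ell) 2" using odd_ell by simp
  moreover have "coprime (int ell) 3" if "half_norm \<alpha> = 3"
  proof -
    have "bad_prime \<Delta> 3"
      using triple_length_G2[OF assms that] unfolding bad_prime_def by (intro exI[of _ TypeG2]) simp
    then have "coprime ell 3" using good by blast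
    then have "coprime (int ell) (int 3)" by (simp only: coprime_int_iff)
    then show ?thesis by simp
  qed
  ultimately show ?thesis
    using half_norm_cases[OF assms] that[of 1] that[of 2] that[of 3] by auto
qed

lemma zeta_power_singular:
  assumes "\<alpha> \<in> singular \<mu>"
  shows "\<zeta> powi root_exponent \<Phi> \<Delta> \<mu> \<alpha> = 1"
proof -
  have a: "\<alpha> \<in> \<Phi>" using assms singular_iff by blast
  obtain k :: int where k: "v \<bullet> coroot \<alpha> = of_int k * real ell" using assms singular_iff by blast
  obtain d where d: "half_norm \<alpha> = of_int d" using half_norm_coprime[OF a] .
  have "real_of_int (root_exponent \<Phi> \<Delta> \<mu> \<alpha>) = real_of_int (int ell * (d * k))"
    using root_exponent(1)[OF a] by (simp add: k d)
  then have "root_exponent \<Phi> \<Delta> \<mu> \<alpha> = int ell * (d * k)" by (simp only: of_int_eq_iff)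
  then show ?thesis using primitive_root_powi_mult[OF primitive] by simp
qed

lemma zeta_factor_nonzero:
  assumes a: "\<alpha> \<in> \<Phi>" and ns: "\<alpha> \<notin> singular \<mu>m"
  shows "\<zeta> powi root_exponent \<Phi> \<Delta> \<mu>m \<alpha> - \<zeta> powi (- root_exponent \<Phi> \<Delta> \<mu>m \<alpha>) \<noteq> 0"
proof
  let ?e = "root_exponent \<Phi> \<Delta> \<mu>m \<alpha>"
  assume "\<zeta> powi ?e - \<zeta> powi (- ?e) = 0"
  then have eq: "\<zeta> powi ?e = \<zeta> powi (- ?e)" by simp
  have "\<zeta> powi (?e + ?e) = \<zeta> powi ?e * \<zeta> powi ?e" using zeta_nonzero by (simp only: power_int_add simp_thms)
  also have "\<dots> = \<zeta> powi ?e * \<zeta> powi (- ?e)" by (simp only: eq[symmetric])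
  also have "\<dots> = \<zeta> powi (?e + - ?e)" using zeta_nonzero by (simp only: power_int_add simp_thms)
  also have "\<dots> = 1" by simp
  finally have "int ell dvd ?e + ?e" by (rule primitive_root_powi_eq_1[OF primitive])
  moreover have "?e + ?e = 2 * ?e" by simp
  moreover have "coprime (int ell) 2" using odd_ell by simp
  ultimately have dv: "int ell dvd ?e" by (metis coprime_dvd_mult_right_iff)
  obtain d where d: "half_norm \<alpha> = of_int d" "coprime (int ell) d" using half_norm_coprime[OF a] .
  obtain c where c: "u \<bullet> coroot \<alpha> = of_int c" using u_int[OF a] by (rule Ints_cases)
  have "real_of_int ?e = real_of_int (d * c)" using root_exponent(2)[OF a] by (simp add: c d)
  then have "?e = d * c" by (simp only: of_int_eq_iff)
  then have "int ell dvd c" using dv d(2) by (metis coprime_dvd_mult_right_iff)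
  then obtain k where "c = int ell * k" by (rule dvdE)
  then have "u \<bullet> coroot \<alpha> = of_int k * real ell" by (simp add: c)
  then show False using ns a singular_iff(2) by blast
qed

text \<open>The sign is \<open>(-1)\<^sup>N\<close> with \<open>N\<close> the number of nonsingular positive roots that \<open>y\<close> makes negative; the singular
ones are \<open>a\<close> in number, and all together have the parity of the length.\<close>

lemma nonsingular_product:
  "(\<Prod>\<alpha>\<in>P - singular_pos \<mu>. \<zeta> powi root_exponent \<Phi> \<Delta> \<mu> \<alpha> - \<zeta> powi (- root_exponent \<Phi> \<Delta> \<mu> \<alpha>)) =
   (- 1) powi (int (coxeter_length \<Delta> \<alpha>0 ell w) -
     int (card {\<beta> \<in> singular_pos \<mu>m. u \<bullet> coroot \<beta> = - real ell})) *
   (\<Prod>\<alpha>\<in>P - singular_pos \<mu>m. \<zeta> powi root_exponent \<Phi> \<Delta> \<mu>m \<alpha> - \<zeta> powi (- root_exponent \<Phi> \<Delta> \<mu>m \<alpha>))"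
proof -
  define g where "g \<beta> = \<zeta> powi root_exponent \<Phi> \<Delta> \<mu>m \<beta> - \<zeta> powi (- root_exponent \<Phi> \<Delta> \<mu>m \<beta>)" for \<beta>
  let ?X = "\<Phi> - singular \<mu>"
  have PX: "P - singular_pos \<mu> = ?X \<inter> P" using pos_root unfolding singular_pos_roots_def by blast
  have yX: "y ` ?X = \<Phi> - singular \<mu>m"
  proof -
    have "y ` ?X \<subseteq> \<Phi> - singular \<mu>m" using y_root singular_y by blast
    moreover have "\<beta> \<in> y ` ?X" if "\<beta> \<in> \<Phi> - singular \<mu>m" for \<beta>
    proof (rule image_eqI[of _ _ "x \<beta>"])
      show "\<beta> = y (x \<beta>)" by (simp add: y_x)
      show "x \<beta> \<in> ?X" using that x_root[of \<beta>] singular_y[of "x \<beta>"] by (simp add: y_x)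
    qed
    ultimately show ?thesis by blast
  qed
  have PY: "y ` ?X \<inter> P = P - singular_pos \<mu>m"
    unfolding yX using pos_root unfolding singular_pos_roots_def by blast
  have factor: "\<zeta> powi root_exponent \<Phi> \<Delta> \<mu> \<alpha> - \<zeta> powi (- root_exponent \<Phi> \<Delta> \<mu> \<alpha>) = g (y \<alpha>)"
    if "\<alpha> \<in> \<Phi>" for \<alpha>
  proof -
    obtain t where t: "root_exponent \<Phi> \<Delta> \<mu> \<alpha> = root_exponent \<Phi> \<Delta> \<mu>m (y \<alpha>) + int ell * t"
      using root_exponent_congruent[OF \<open>\<alpha> \<in> \<Phi>\<close>] by blast
    then have t': "- root_exponent \<Phi> \<Delta> \<mu> \<alpha> = - root_exponent \<Phi> \<Delta> \<mu>m (y \<alpha>) + int ell * (- t)" by simp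
    have "\<zeta> powi (i + int ell * j) = \<zeta> powi i" for i j
      using zeta_nonzero primitive_root_powi_mult[OF primitive, of j] by (simp add: power_int_add)
    then show ?thesis unfolding t' unfolding t g_def by (simp only:)
  qed
  let ?N = "card {\<alpha> \<in> ?X \<inter> P. y \<alpha> \<notin> P}"
  let ?a = "card {\<beta> \<in> singular_pos \<mu>m. u \<bullet> coroot \<beta> = - real ell}"
  have "(\<Prod>\<alpha>\<in>P - singular_pos \<mu>. \<zeta> powi root_exponent \<Phi> \<Delta> \<mu> \<alpha> - \<zeta> powi (- root_exponent \<Phi> \<Delta> \<mu> \<alpha>)) =
      (\<Prod>\<alpha>\<in>?X \<inter> P. g (y \<alpha>))"
    unfolding PX by (intro prod.cong refl factor) simp
  also have "\<dots> = (- 1) ^ ?N * (\<Prod>\<beta>\<in>y ` ?X \<inter> P. g \<beta>)"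
  proof (rule prod_odd_function)
    show "y ` ?X \<subseteq> \<Phi>" using y_root by blast
    show "g (- \<beta>) = - g \<beta>" if "\<beta> \<in> \<Phi>" for \<beta> by (simp add: g_def root_exponent_minus[OF that])
  qed (simp_all add: inj_y y_minus singular_minus)
  also have "(- 1 :: complex) ^ ?N = (- 1) powi (int (coxeter_length \<Delta> \<alpha>0 ell w) - int ?a)"
  proof -
    have un: "{\<alpha> \<in> P. y \<alpha> \<notin> P} = {\<alpha> \<in> ?X \<inter> P. y \<alpha> \<notin> P} \<union> {\<alpha> \<in> singular_pos \<mu>. y \<alpha> \<notin> P}"
      using pos_root unfolding singular_pos_roots_def by blast
    have "card {\<alpha> \<in> P. y \<alpha> \<notin> P} = ?N + ?a"
      unfolding un card_singular_sign_changes[symmetric]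
      by (rule card_Un_disjoint) (auto simp: singular_pos_roots_def finite_pos)
    then have "even (coxeter_length \<Delta> \<alpha>0 ell w) \<longleftrightarrow> even (?N + ?a)" using parity_length by simp
    then show ?thesis by (auto simp: power_int_diff minus_one_power_iff)
  qed
  finally show ?thesis unfolding PY g_def .
qed

text \<open>The product rule at \<open>\<zeta>\<close>, applied with the singular factors as the vanishing ones.\<close>

lemma derivative_formula:
  defines "A \<equiv> \<Prod>\<alpha>\<in>singular_pos \<mu>. of_real (2 * half_norm \<alpha> * (v \<bullet> coroot \<alpha>)) * inverse \<zeta>"
    and "B \<equiv> \<Prod>\<alpha>\<in>P - singular_pos \<mu>m.
      \<zeta> powi root_exponent \<Phi> \<Delta> \<mu>m \<alpha> - \<zeta> powi (- root_exponent \<Phi> \<Delta> \<mu>m \<alpha>)"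
    and "s \<equiv> card (singular_pos \<mu>)"
    and "a \<equiv> card {\<beta> \<in> singular_pos \<mu>m. u \<bullet> coroot \<beta> = - real ell}"
  shows "laurent_eval ((fls_deriv ^^ s) (weyl_denominator_poly \<Phi> \<Delta> \<mu>)) \<zeta> =
      (- 1) powi (int (coxeter_length \<Delta> \<alpha>0 ell w) - int a) * fact s * A * B"
    and "A \<noteq> 0" and "B \<noteq> 0"
proof -
  let ?f = "\<lambda>\<alpha>. fls_X_intpow (root_exponent \<Phi> \<Delta> \<mu> \<alpha>) - fls_X_intpow (- root_exponent \<Phi> \<Delta> \<mu> \<alpha>) :: int fls"
  let ?I = "singular_pos \<mu>"
  have sub: "?I \<subseteq> P" unfolding singular_pos_roots_def by blast
  have fin: "finite ?I" by (rule finite_subset[OF sub finite_pos])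
  have pow: "\<zeta> powi root_exponent \<Phi> \<Delta> \<mu> \<alpha> = 1" "\<zeta> powi (- root_exponent \<Phi> \<Delta> \<mu> \<alpha>) = 1" if "\<alpha> \<in> ?I" for \<alpha>
    using that zeta_power_singular[of \<alpha>] unfolding singular_pos_roots_def by (simp_all add: power_int_minus)
  have ev: "laurent_eval (?f \<alpha>) \<zeta> = 0" if "\<alpha> \<in> ?I" for \<alpha>
    by (simp only: laurent_quantum_factor(2) pow[OF that] diff_self)
  have dev: "laurent_eval (fls_deriv (?f \<alpha>)) \<zeta> = of_real (2 * half_norm \<alpha> * (v \<bullet> coroot \<alpha>)) * inverse \<zeta>"
    if "\<alpha> \<in> ?I" for \<alpha>
  proof -
    have "\<alpha> \<in> \<Phi>" using that sub pos_root by blast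
    then have "complex_of_real (half_norm \<alpha> * (v \<bullet> coroot \<alpha>)) = of_int (root_exponent \<Phi> \<Delta> \<mu> \<alpha>)"
      by (simp only: root_exponent(1)[symmetric] of_real_of_int_eq)
    then show ?thesis
      unfolding laurent_quantum_factor(3)[OF zeta_nonzero] pow[OF that] by (simp add: mult.assoc)
  qed
  have "weyl_denominator_poly \<Phi> \<Delta> \<mu> = prod ?f ?I * prod ?f (P - ?I)"
    unfolding weyl_denominator_poly_def prod.subset_diff[OF sub finite_pos] by (rule mult.commute)
  then have "laurent_eval ((fls_deriv ^^ s) (weyl_denominator_poly \<Phi> \<Delta> \<mu>)) \<zeta> =
      fact s * (\<Prod>\<alpha>\<in>?I. laurent_eval (fls_deriv (?f \<alpha>)) \<zeta>) * laurent_eval (prod ?f (P - ?I)) \<zeta>"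
    unfolding s_def
    using laurent_eval_derivs_prod[OF zeta_nonzero fin, of "prod ?f (P - ?I)" ?f]
    by (simp only: ev laurent_polynomial_prod laurent_quantum_factor(1))
  also have "(\<Prod>\<alpha>\<in>?I. laurent_eval (fls_deriv (?f \<alpha>)) \<zeta>) = A"
    unfolding A_def by (intro prod.cong refl dev)
  also have "laurent_eval (prod ?f (P - ?I)) \<zeta> =
      (\<Prod>\<alpha>\<in>P - ?I. \<zeta> powi root_exponent \<Phi> \<Delta> \<mu> \<alpha> - \<zeta> powi (- root_exponent \<Phi> \<Delta> \<mu> \<alpha>))"
    by (simp only: laurent_polynomial_prod(2)[OF laurent_quantum_factor(1) zeta_nonzero]
        laurent_quantum_factor(2))
  also have "\<dots> = (- 1) powi (int (coxeter_length \<Delta> \<alpha>0 ell w) - int a) * B"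
    unfolding a_def B_def by (rule nonsingular_product)
  finally show "laurent_eval ((fls_deriv ^^ s) (weyl_denominator_poly \<Phi> \<Delta> \<mu>)) \<zeta> =
      (- 1) powi (int (coxeter_length \<Delta> \<alpha>0 ell w) - int a) * fact s * A * B"
    by (simp only: ac_simps)
  have "2 * half_norm \<alpha> * (v \<bullet> coroot \<alpha>) \<noteq> 0" if "\<alpha> \<in> ?I" for \<alpha>
  proof -
    have p: "\<alpha> \<in> P" using that sub by blast
    have "half_norm \<alpha> * (v \<bullet> coroot \<alpha>) = v \<bullet> \<alpha>"
      by (rule inner_eq_half_norm[OF root_nonzero[OF pos_root[OF p]]])
    then show ?thesis using v_pos[OF p] by auto
  qed
  then show "A \<noteq> 0"
    unfolding A_def using fin zeta_nonzero by (simp add: prod_zero_iff)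
  show "B \<noteq> 0"
    unfolding B_def prod_zero_iff[OF finite_Diff[OF finite_pos]]
    using zeta_factor_nonzero pos_root unfolding singular_pos_roots_def by blast
qed

end

theorem theorem2p4:
  fixes \<Phi> \<Delta> :: "'a::euclidean_space set"
    and \<alpha>0 \<mu>m \<mu> \<theta> :: 'a
    and w x :: "'a \<Rightarrow> 'a"
    and ell s a :: nat
    and \<zeta> :: complex
  assumes "irreducible_root_system \<Phi>"
    and "normalized \<Phi>"
    and "simple_roots \<Phi> \<Delta>"
    and "maximal_short_root \<Phi> \<Delta> \<alpha>0"
    and "odd ell"
    and "real ell > coxeter_number \<Phi> \<Delta> \<alpha>0"
    and "\<forall>p. bad_prime \<Delta> p \<longrightarrow> coprime ell p"
    and "primitive_root_of_unity ell \<zeta>"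
    and "\<mu>m \<in> closed_antidominant_alcove_weights \<Phi> \<Delta> ell"
    and "\<theta> \<in> root_lattice \<Phi>"
    and "x \<in> weyl_group \<Phi>"
    and "w = translation (of_nat ell *\<^sub>R \<theta>) \<circ> x"
    and "minimal_dominant \<Phi> \<Delta> \<alpha>0 ell \<mu>m w"
    and "\<mu> = dot_action \<Phi> \<Delta> w \<mu>m"
    and "s = card (singular_pos_roots \<Phi> \<Delta> ell \<mu>)"
    and "a = card {\<alpha> \<in> singular_pos_roots \<Phi> \<Delta> ell \<mu>m.
                     (\<mu>m + rho \<Phi> \<Delta>) \<bullet> coroot \<alpha> = - of_nat ell}"
  shows "laurent_eval ((fls_deriv ^^ s) (weyl_denominator_poly \<Phi> \<Delta> \<mu>)) \<zeta> \<noteq> 0 \<and>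
    laurent_eval ((fls_deriv ^^ s) (weyl_denominator_poly \<Phi> \<Delta> \<mu>)) \<zeta> =
      (- 1) powi (int (coxeter_length \<Delta> \<alpha>0 ell w) - int a) * of_nat (fact s) *
      (\<Prod>\<alpha>\<in>singular_pos_roots \<Phi> \<Delta> ell \<mu>.
         of_real (2 * half_norm \<alpha> * ((\<mu> + rho \<Phi> \<Delta>) \<bullet> coroot \<alpha>)) * inverse \<zeta>) *
      (\<Prod>\<alpha>\<in>pos_roots \<Phi> \<Delta> - singular_pos_roots \<Phi> \<Delta> ell \<mu>m.
         \<zeta> powi root_exponent \<Phi> \<Delta> \<mu>m \<alpha> - \<zeta> powi (- root_exponent \<Phi> \<Delta> \<mu>m \<alpha>))"
proof -
  have "root_system \<Phi>" using assms(1) unfolding irreducible_root_system_def by blast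
  then interpret S: root_of_unity_setting \<Phi> \<Delta> \<alpha>0 ell \<mu>m \<theta> w x \<zeta>
    using assms(1-13) by unfold_locales
  have mu: "\<mu> = S.\<mu>" unfolding S.\<mu>_def by (rule assms(14))
  have v: "\<mu> + rho \<Phi> \<Delta> = S.v" unfolding S.v_def mu by (rule refl)
  have u: "\<mu>m + rho \<Phi> \<Delta> = S.u" unfolding S.u_def by (rule refl)
  show ?thesis
    unfolding assms(15,16) v u unfolding mu S.derivative_formula(1) of_nat_fact
    using S.derivative_formula(2,3) by simp
qed

end
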